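(* Let $(G,\le)$ be a nonempty totally ordered set and let $\Omega=\{\Omega_k\}_{k\in G}$ be a pre-stratifying system in an abelian length category $\mathcal{A}$ (as in the context). 1. There exist at least one nested family of torsion pairs $\Gamma=\{(\mathcal{T}_k,\mathcal{F}_k)\}_{k\in G}$ in $\mathcal{A}$ and at least one object $M_\bullet\in\mathcal{M}^{\dagger}(\Gamma)$ such that $\Omega$ is induced as a quotient of $M_\bullet$, i.e. $\Omega_k\cong\mathfrak{F}_k(M_\bullet)$ for all $k\in G$. 2. There exist at least one nested family of torsion pairs $\Gamma'=\{(\mathcal{T}'_k,\mathcal{F}'_k)\}_{k\in G}$ in $\mathcal{A}$ and at least one object $N_\bullet\in\mathcal{N}^{\dagger}(\Gamma')$ such that $\Omega$ is induced as a subobject of $N_\bullet$, i.e. $\Omega_k\cong\mathfrak{T}_k(N_\bullet)$ for all $k\in G$, where $\mathfrak{T}_k$ is taken with respect to $\Gamma'$.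
   Context: Throughout, $\mathcal{A}$ is a $k$-linear, Hom-finite, skeletally small abelian category over an algebraically closed field $k$, in which every object has finite length. For a class $\mathcal{C}$, $\mathcal{C}^{\bot}=\{M\mid \mathrm{Hom}_{\mathcal{A}}(C,M)=0\ \forall C\in\mathcal{C}\}$ and ${}^{\bot}\mathcal{C}=\{M\mid \mathrm{Hom}_{\mathcal{A}}(M,C)=0\ \forall C\in\mathcal{C}\}$. A torsion pair $(\mathcal{T},\mathcal{F})$ is a pair of full subcategories with no non-zero morphisms from $\mathcal{T}$ to $\mathcal{F}$ such that each $M\in\mathcal{A}$ admits a (unique up to isomorphism) short exact sequence $0\to t(M)\to M\to f(M)\to0$ with $t(M)\in\mathcal{T}$ (the torsion part) and $f(M)\in\mathcal{F}$ (the torsion-free part). A nested family of torsion pairs indexed by $G$ is a family $\{(\mathcal{T}_k,\mathcal{F}_k)\}_{k\in G}$ of torsion pairs with $\mathcal{T}_k\supsetneq\mathcal{T}_l$ whenever $k<l$ (equivalently $\mathcal{F}_k\subsetneq\mathcal{F}_l$). A pre-stratifying system indexed by $G$ is a family $\{\Omega_k\}_{k\in G}$ of non-zero objects with $\mathrm{Hom}_{\mathcal{A}}(\Omega_k,\Omega_j)=0$ whenever $k>j$ and $\mathrm{Ext}^1_{\mathcal{A}}(\Omega_k,\Omega_j)=0$ whenever $k\ge j$. $\mathrm{Gr}_G(\mathcal{A})$ is the category of families $(M_k)_{k\in G}$ of objects of $\mathcal{A}$ with componentwise morphisms; $0_\bullet=(0)_{k\in G}$. $\mathcal{M}(\Gamma)$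 is the full subcategory consisting of $0_\bullet$ and the $(M_k)$ such that for all $k$: $M_k\ne0$, $M_k\in\mathcal{T}_k$, and $M_k\notin\mathcal{T}_j$ whenever $j>k$. $\mathcal{N}(\Gamma)$ consists of $0_\bullet$ and the $(N_k)$ such that for all $k$: $N_k\ne0$, $N_k\in\mathcal{F}_k$, and $N_k\notin\mathcal{F}_j$ whenever $j<k$. For $M_\bullet\in\mathcal{M}(\Gamma)$, $\mathfrak{F}_k(M_\bullet)$ is the torsion-free part of $M_k$ with respect to the torsion pair $({}^{\bot}(\bigcap_{j>k}\mathcal{F}_j),\ \bigcap_{j>k}\mathcal{F}_j)$, where $\bigcap_{j>k}\mathcal{F}_j:=\mathcal{A}$ if $k$ is the maximum of $G$. For $N_\bullet\in\mathcal{N}(\Gamma)$, $\mathfrak{T}_k(N_\bullet)$ is the torsion part of $N_k$ with respect to the torsion pair $(\bigcap_{j<k}\mathcal{T}_j,\ (\bigcap_{j<k}\mathcal{T}_j)^{\bot})$, where $\bigcap_{j<k}\mathcal{T}_j:=\mathcal{A}$ if $k$ is the minimum of $G$. Both are determined up to isomorphism. $\mathcal{M}^{\dagger}(\Gamma)$ is the full subcategory of $\mathcal{M}(\Gamma)$ of all non-zero $M_\bullet$ with $\mathrm{Ext}^1_{\mathcal{A}}(M_k,\mathfrak{F}_j(M_\bullet))=0$ for all $k\ge j$. $\mathcal{N}^{\dagger}(\Gamma)$ is the full subcategory of $\mathcal{N}(\Gamma)$ of all non-zero $N_\bullet$ with $\mathrm{Ext}^1_{\mathcal{A}}(\mathfrak{T}_k(N_\bullet),N_j)=0$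 for all $k\ge j$. *)

theory Defs
  imports "HOL-Algebra.Algebra"
begin

text \<open>Otherwise \<open>X\<close> could not be used as a variable.\<close>

no_notation var (\<open>X\<index>\<close>)

text \<open>
  A category is presented by its hom-spaces, indexed by source and target. Each hom-space carries
  its vector space structure as a \<open>module\<close> record, whose ring multiplication and unit are never
  used. Hom-spaces of distinct pairs of objects may overlap, so that the laws below are always
  relative to chosen objects. The objects form a set, hence every category considered is small,
  which is what a skeletally small category amounts to up to equivalence.
\<close>

record ('k, 'o, 'm) linear_cat =
  Ob :: "'o set"
  Hom :: "'o \<Rightarrow> 'o \<Rightarrow> ('k, 'm) module"
  ident :: "'o \<Rightarrow> 'm"
  comp :: "'m \<Rightarrow> 'm \<Rightarrow> 'm"  (infixl "\<cdot>\<index>" 70)  \<comment> \<open>\<open>g \<cdot> f\<close> is \<open>g\<close> after \<open>f\<close>\<close>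

abbreviation hom_set :: "('k, 'o, 'm) linear_cat \<Rightarrow> 'o \<Rightarrow> 'o \<Rightarrow> 'm set" where
  "hom_set A X Y \<equiv> carrier (Hom A X Y)"

locale linear_category = field K
  for K :: "('k, 'r) ring_scheme" (structure) and A :: "('k, 'o, 'm) linear_cat" +
  assumes hom_module: "\<lbrakk>X \<in> Ob A; Y \<in> Ob A\<rbrakk> \<Longrightarrow> module K (Hom A X Y)"
    and ident_closed: "X \<in> Ob A \<Longrightarrow> ident A X \<in> hom_set A X X"
    and comp_closed: "\<lbrakk>X \<in> Ob A; Y \<in> Ob A; Z \<in> Ob A; f \<in> hom_set A X Y; g \<in> hom_set A Y Z\<rbrakk>
          \<Longrightarrow> g \<cdot>\<^bsub>A\<^esub> f \<in> hom_set A X Z"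
    and comp_ident_right: "\<lbrakk>X \<in> Ob A; Y \<in> Ob A; f \<in> hom_set A X Y\<rbrakk> \<Longrightarrow> f \<cdot>\<^bsub>A\<^esub> ident A X = f"
    and comp_ident_left: "\<lbrakk>X \<in> Ob A; Y \<in> Ob A; f \<in> hom_set A X Y\<rbrakk> \<Longrightarrow> ident A Y \<cdot>\<^bsub>A\<^esub> f = f"
    and comp_assoc: "\<lbrakk>W \<in> Ob A; X \<in> Ob A; Y \<in> Ob A; Z \<in> Ob A;
            f \<in> hom_set A W X; g \<in> hom_set A X Y; h \<in> hom_set A Y Z\<rbrakk>
          \<Longrightarrow> (h \<cdot>\<^bsub>A\<^esub> g) \<cdot>\<^bsub>A\<^esub> f = h \<cdot>\<^bsub>A\<^esub> (g \<cdot>\<^bsub>A\<^esub> f)"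
    and comp_add_right: "\<lbrakk>X \<in> Ob A; Y \<in> Ob A; Z \<in> Ob A;
            f \<in> hom_set A X Y; f' \<in> hom_set A X Y; g \<in> hom_set A Y Z\<rbrakk>
          \<Longrightarrow> g \<cdot>\<^bsub>A\<^esub> (f \<oplus>\<^bsub>Hom A X Y\<^esub> f') = (g \<cdot>\<^bsub>A\<^esub> f) \<oplus>\<^bsub>Hom A X Z\<^esub> (g \<cdot>\<^bsub>A\<^esub> f')"
    and comp_add_left: "\<lbrakk>X \<in> Ob A; Y \<in> Ob A; Z \<in> Ob A;
            f \<in> hom_set A X Y; g \<in> hom_set A Y Z; g' \<in> hom_set A Y Z\<rbrakk>
          \<Longrightarrow> (g \<oplus>\<^bsub>Hom A Y Z\<^esub> g') \<cdot>\<^bsub>A\<^esub> f = (g \<cdot>\<^bsub>A\<^esub> f) \<oplus>\<^bsub>Hom A X Z\<^esub> (g' \<cdot>\<^bsub>A\<^esub> f)"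
    and comp_smult_right: "\<lbrakk>X \<in> Ob A; Y \<in> Ob A; Z \<in> Ob A; a \<in> carrier K;
            f \<in> hom_set A X Y; g \<in> hom_set A Y Z\<rbrakk>
          \<Longrightarrow> g \<cdot>\<^bsub>A\<^esub> (a \<odot>\<^bsub>Hom A X Y\<^esub> f) = a \<odot>\<^bsub>Hom A X Z\<^esub> (g \<cdot>\<^bsub>A\<^esub> f)"
    and comp_smult_left: "\<lbrakk>X \<in> Ob A; Y \<in> Ob A; Z \<in> Ob A; a \<in> carrier K;
            f \<in> hom_set A X Y; g \<in> hom_set A Y Z\<rbrakk>
          \<Longrightarrow> (a \<odot>\<^bsub>Hom A Y Z\<^esub> g) \<cdot>\<^bsub>A\<^esub> f = a \<odot>\<^bsub>Hom A X Z\<^esub> (g \<cdot>\<^bsub>A\<^esub> f)"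

definition hom_zero :: "('k, 'o, 'm) linear_cat \<Rightarrow> 'o \<Rightarrow> 'o \<Rightarrow> bool" where
  "hom_zero A X Y \<longleftrightarrow> hom_set A X Y = {\<zero>\<^bsub>Hom A X Y\<^esub>}"

definition zero_object :: "('k, 'o, 'm) linear_cat \<Rightarrow> 'o \<Rightarrow> bool" where
  "zero_object A Z \<longleftrightarrow> Z \<in> Ob A \<and>
     (\<forall>X\<in>Ob A. (\<exists>!f. f \<in> hom_set A X Z) \<and> (\<exists>!f. f \<in> hom_set A Z X))"

definition isomorphism :: "('k, 'o, 'm) linear_cat \<Rightarrow> 'o \<Rightarrow> 'o \<Rightarrow> 'm \<Rightarrow> bool" where
  "isomorphism A X Y f \<longleftrightarrow> X \<in> Ob A \<and> Y \<in> Ob A \<and> f \<in> hom_set A X Y \<and>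
     (\<exists>g\<in>hom_set A Y X. g \<cdot>\<^bsub>A\<^esub> f = ident A X \<and> f \<cdot>\<^bsub>A\<^esub> g = ident A Y)"

definition isomorphic :: "('k, 'o, 'm) linear_cat \<Rightarrow> 'o \<Rightarrow> 'o \<Rightarrow> bool" where
  "isomorphic A X Y \<longleftrightarrow> (\<exists>f. isomorphism A X Y f)"

definition monomorphism :: "('k, 'o, 'm) linear_cat \<Rightarrow> 'o \<Rightarrow> 'o \<Rightarrow> 'm \<Rightarrow> bool" where
  "monomorphism A X Y f \<longleftrightarrow> X \<in> Ob A \<and> Y \<in> Ob A \<and> f \<in> hom_set A X Y \<and>
     (\<forall>W\<in>Ob A. \<forall>g\<in>hom_set A W X. \<forall>h\<in>hom_set A W X. f \<cdot>\<^bsub>A\<^esub> g = f \<cdot>\<^bsub>A\<^esub> h \<longrightarrow> g = h)"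

definition epimorphism :: "('k, 'o, 'm) linear_cat \<Rightarrow> 'o \<Rightarrow> 'o \<Rightarrow> 'm \<Rightarrow> bool" where
  "epimorphism A X Y f \<longleftrightarrow> X \<in> Ob A \<and> Y \<in> Ob A \<and> f \<in> hom_set A X Y \<and>
     (\<forall>W\<in>Ob A. \<forall>g\<in>hom_set A Y W. \<forall>h\<in>hom_set A Y W. g \<cdot>\<^bsub>A\<^esub> f = h \<cdot>\<^bsub>A\<^esub> f \<longrightarrow> g = h)"

text \<open>\<open>is_kernel A N X Y i f\<close>: the morphism \<open>i : N \<rightarrow> X\<close> is a kernel of \<open>f : X \<rightarrow> Y\<close>.\<close>

definition is_kernel ::
    "('k, 'o, 'm) linear_cat \<Rightarrow> 'o \<Rightarrow> 'o \<Rightarrow> 'o \<Rightarrow> 'm \<Rightarrow> 'm \<Rightarrow> bool" where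
  "is_kernel A N X Y i f \<longleftrightarrow> N \<in> Ob A \<and> X \<in> Ob A \<and> Y \<in> Ob A \<and>
     i \<in> hom_set A N X \<and> f \<in> hom_set A X Y \<and> f \<cdot>\<^bsub>A\<^esub> i = \<zero>\<^bsub>Hom A N Y\<^esub> \<and>
     (\<forall>W\<in>Ob A. \<forall>h\<in>hom_set A W X. f \<cdot>\<^bsub>A\<^esub> h = \<zero>\<^bsub>Hom A W Y\<^esub> \<longrightarrow>
        (\<exists>!u. u \<in> hom_set A W N \<and> i \<cdot>\<^bsub>A\<^esub> u = h))"

text \<open>\<open>is_cokernel A X Y C f p\<close>: the morphism \<open>p : Y \<rightarrow> C\<close> is a cokernel of \<open>f : X \<rightarrow> Y\<close>.\<close>

definition is_cokernel ::
    "('k, 'o, 'm) linear_cat \<Rightarrow> 'o \<Rightarrow> 'o \<Rightarrow> 'o \<Rightarrow> 'm \<Rightarrow> 'm \<Rightarrow> bool" where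
  "is_cokernel A X Y C f p \<longleftrightarrow> X \<in> Ob A \<and> Y \<in> Ob A \<and> C \<in> Ob A \<and>
     f \<in> hom_set A X Y \<and> p \<in> hom_set A Y C \<and> p \<cdot>\<^bsub>A\<^esub> f = \<zero>\<^bsub>Hom A X C\<^esub> \<and>
     (\<forall>W\<in>Ob A. \<forall>h\<in>hom_set A Y W. h \<cdot>\<^bsub>A\<^esub> f = \<zero>\<^bsub>Hom A X W\<^esub> \<longrightarrow>
        (\<exists>!u. u \<in> hom_set A C W \<and> u \<cdot>\<^bsub>A\<^esub> p = h))"

definition is_biproduct ::
    "('k, 'o, 'm) linear_cat \<Rightarrow> 'o \<Rightarrow> 'o \<Rightarrow> 'o \<Rightarrow> 'm \<Rightarrow> 'm \<Rightarrow> 'm \<Rightarrow> 'm \<Rightarrow> bool" where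
  "is_biproduct A X Y B iX iY pX pY \<longleftrightarrow> X \<in> Ob A \<and> Y \<in> Ob A \<and> B \<in> Ob A \<and>
     iX \<in> hom_set A X B \<and> iY \<in> hom_set A Y B \<and> pX \<in> hom_set A B X \<and> pY \<in> hom_set A B Y \<and>
     pX \<cdot>\<^bsub>A\<^esub> iX = ident A X \<and> pY \<cdot>\<^bsub>A\<^esub> iY = ident A Y \<and>
     pX \<cdot>\<^bsub>A\<^esub> iY = \<zero>\<^bsub>Hom A Y X\<^esub> \<and> pY \<cdot>\<^bsub>A\<^esub> iX = \<zero>\<^bsub>Hom A X Y\<^esub> \<and>
     (iX \<cdot>\<^bsub>A\<^esub> pX) \<oplus>\<^bsub>Hom A B B\<^esub> (iY \<cdot>\<^bsub>A\<^esub> pY) = ident A B"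

text \<open>\<open>short_exact A X Y Z i p\<close>: exactness of \<open>0 \<rightarrow> X \<rightarrow> Y \<rightarrow> Z \<rightarrow> 0\<close> with maps \<open>i\<close> and \<open>p\<close>.\<close>

definition short_exact ::
    "('k, 'o, 'm) linear_cat \<Rightarrow> 'o \<Rightarrow> 'o \<Rightarrow> 'o \<Rightarrow> 'm \<Rightarrow> 'm \<Rightarrow> bool" where
  "short_exact A X Y Z i p \<longleftrightarrow> is_kernel A X Y Z i p \<and> is_cokernel A X Y Z i p"

definition simple_object :: "('k, 'o, 'm) linear_cat \<Rightarrow> 'o \<Rightarrow> bool" where
  "simple_object A S \<longleftrightarrow> S \<in> Ob A \<and> \<not> zero_object A S \<and>
     (\<forall>X i. monomorphism A X S i \<longrightarrow> zero_object A X \<or> isomorphism A X S i)"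

text \<open>The filtration \<open>X 0 \<subseteq> \<dots> \<subseteq> X n\<close> is a composition series.\<close>

definition finite_length :: "('k, 'o, 'm) linear_cat \<Rightarrow> 'o \<Rightarrow> bool" where
  "finite_length A M \<longleftrightarrow> (\<exists>(n::nat) X i. zero_object A (X 0) \<and> X n = M \<and>
     (\<forall>l<n. \<exists>S p. simple_object A S \<and> short_exact A (X l) (X (Suc l)) S (i l) p))"

definition finite_dim :: "('k, 'r) ring_scheme \<Rightarrow> ('k, 'm) module \<Rightarrow> bool" where
  "finite_dim K V \<longleftrightarrow> (\<exists>B. finite B \<and> B \<subseteq> carrier V \<and>
     (\<forall>v\<in>carrier V. \<exists>c\<in>B \<rightarrow> carrier K. v = (\<Oplus>\<^bsub>V\<^esub>b\<in>B. c b \<odot>\<^bsub>V\<^esub> b)))"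

locale abelian_length_category = linear_category K A + algebraically_closed K
  for K :: "('k, 'r) ring_scheme" (structure) and A :: "('k, 'o, 'm) linear_cat" +
  assumes ex_zero_object: "\<exists>Z. zero_object A Z"
    and ex_biproduct: "\<lbrakk>X \<in> Ob A; Y \<in> Ob A\<rbrakk> \<Longrightarrow> \<exists>B iX iY pX pY. is_biproduct A X Y B iX iY pX pY"
    and ex_kernel: "\<lbrakk>X \<in> Ob A; Y \<in> Ob A; f \<in> hom_set A X Y\<rbrakk> \<Longrightarrow> \<exists>N i. is_kernel A N X Y i f"
    and ex_cokernel: "\<lbrakk>X \<in> Ob A; Y \<in> Ob A; f \<in> hom_set A X Y\<rbrakk> \<Longrightarrow> \<exists>C p. is_cokernel A X Y C f p"
    and mono_is_kernel: "monomorphism A X Y f \<Longrightarrow> \<exists>Z g. is_kernel A X Y Z f g"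
    and epi_is_cokernel: "epimorphism A X Y f \<Longrightarrow> \<exists>W g. is_cokernel A W X Y g f"
    and hom_finite: "\<lbrakk>X \<in> Ob A; Y \<in> Ob A\<rbrakk> \<Longrightarrow> finite_dim K (Hom A X Y)"
    and all_finite_length: "X \<in> Ob A \<Longrightarrow> finite_length A X"

text \<open>
  \<open>Ext\<^sup>1(X, Y)\<close> is taken in the sense of Yoneda: \<open>(E, i, p)\<close> stands for the extension
  \<open>0 \<rightarrow> Y \<rightarrow> E \<rightarrow> X \<rightarrow> 0\<close>, and extensions are identified if they are isomorphic by a map inducing
  the identity on both ends. The zero element is the class of the split extensions \<open>Y \<oplus> X\<close>.
\<close>

definition extensions ::
    "('k, 'o, 'm) linear_cat \<Rightarrow> 'o \<Rightarrow> 'o \<Rightarrow> ('o \<times> 'm \<times> 'm) set" where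
  "extensions A X Y = {(E, i, p). short_exact A Y E X i p}"

definition ext_rel ::
    "('k, 'o, 'm) linear_cat \<Rightarrow> 'o \<Rightarrow> 'o \<Rightarrow> (('o \<times> 'm \<times> 'm) \<times> ('o \<times> 'm \<times> 'm)) set" where
  "ext_rel A X Y = {((E, i, p), (E', i', p')).
     (E, i, p) \<in> extensions A X Y \<and> (E', i', p') \<in> extensions A X Y \<and>
     (\<exists>f. isomorphism A E E' f \<and> f \<cdot>\<^bsub>A\<^esub> i = i' \<and> p' \<cdot>\<^bsub>A\<^esub> f = p)}"

definition Ext1 ::
    "('k, 'o, 'm) linear_cat \<Rightarrow> 'o \<Rightarrow> 'o \<Rightarrow> ('o \<times> 'm \<times> 'm) set set" where
  "Ext1 A X Y = extensions A X Y // ext_rel A X Y"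

definition Ext1_zero ::
    "('k, 'o, 'm) linear_cat \<Rightarrow> 'o \<Rightarrow> 'o \<Rightarrow> ('o \<times> 'm \<times> 'm) set" where
  "Ext1_zero A X Y = ext_rel A X Y ``
     {(B, iY, pX) | B iX iY pX pY. is_biproduct A X Y B iX iY pX pY}"

definition ext1_vanishes :: "('k, 'o, 'm) linear_cat \<Rightarrow> 'o \<Rightarrow> 'o \<Rightarrow> bool" where
  "ext1_vanishes A X Y \<longleftrightarrow> Ext1 A X Y = {Ext1_zero A X Y}"

definition right_perp :: "('k, 'o, 'm) linear_cat \<Rightarrow> 'o set \<Rightarrow> 'o set" where
  "right_perp A C = {M \<in> Ob A. \<forall>X\<in>C. hom_zero A X M}"

definition left_perp :: "('k, 'o, 'm) linear_cat \<Rightarrow> 'o set \<Rightarrow> 'o set" where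
  "left_perp A C = {M \<in> Ob A. \<forall>X\<in>C. hom_zero A M X}"

text \<open>Full subcategories are given by their objects, and are closed under isomorphism.\<close>

definition full_subcategory :: "('k, 'o, 'm) linear_cat \<Rightarrow> 'o set \<Rightarrow> bool" where
  "full_subcategory A S \<longleftrightarrow> S \<subseteq> Ob A \<and> (\<forall>X\<in>S. \<forall>Y. isomorphic A X Y \<longrightarrow> Y \<in> S)"

definition torsion_sequence ::
    "('k, 'o, 'm) linear_cat \<Rightarrow> 'o set \<Rightarrow> 'o set \<Rightarrow> 'o \<Rightarrow> 'o \<Rightarrow> 'o \<Rightarrow> bool" where
  "torsion_sequence A T F X M Y \<longleftrightarrow> X \<in> T \<and> Y \<in> F \<and> (\<exists>i p. short_exact A X M Y i p)"

definition torsion_pair :: "('k, 'o, 'm) linear_cat \<Rightarrow> 'o set \<Rightarrow> 'o set \<Rightarrow> bool" where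
  "torsion_pair A T F \<longleftrightarrow> full_subcategory A T \<and> full_subcategory A F \<and>
     (\<forall>X\<in>T. \<forall>Y\<in>F. hom_zero A X Y) \<and>
     (\<forall>M\<in>Ob A. \<exists>X Y. torsion_sequence A T F X M Y)"

text \<open>
  For a torsion pair these parts exist and are unique up to isomorphism; a representative is chosen.
\<close>

definition torsion_part :: "('k, 'o, 'm) linear_cat \<Rightarrow> 'o set \<Rightarrow> 'o set \<Rightarrow> 'o \<Rightarrow> 'o" where
  "torsion_part A T F M = (SOME X. \<exists>Y. torsion_sequence A T F X M Y)"

definition torsion_free_part :: "('k, 'o, 'm) linear_cat \<Rightarrow> 'o set \<Rightarrow> 'o set \<Rightarrow> 'o \<Rightarrow> 'o" where
  "torsion_free_part A T F M = (SOME Y. \<exists>X. torsion_sequence A T F X M Y)"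

text \<open>
  The index set \<open>G\<close> is a type of class \<open>linorder\<close> (types are nonempty). For a family
  \<open>\<Gamma>\<close> the pair \<open>\<Gamma> k\<close> consists of the torsion class and the torsion-free class at \<open>k\<close>.
\<close>

definition nested_torsion_pairs ::
    "('k, 'o, 'm) linear_cat \<Rightarrow> ('g::linorder \<Rightarrow> 'o set \<times> 'o set) \<Rightarrow> bool" where
  "nested_torsion_pairs A \<Gamma> \<longleftrightarrow> (\<forall>k. torsion_pair A (fst (\<Gamma> k)) (snd (\<Gamma> k))) \<and>
     (\<forall>k l. k < l \<longrightarrow> fst (\<Gamma> l) \<subset> fst (\<Gamma> k))"

definition pre_stratifying_system ::
    "('k, 'o, 'm) linear_cat \<Rightarrow> ('g::linorder \<Rightarrow> 'o) \<Rightarrow> bool" where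
  "pre_stratifying_system A \<Omega> \<longleftrightarrow> (\<forall>k. \<Omega> k \<in> Ob A \<and> \<not> zero_object A (\<Omega> k)) \<and>
     (\<forall>k j. k > j \<longrightarrow> hom_zero A (\<Omega> k) (\<Omega> j)) \<and>
     (\<forall>k j. k \<ge> j \<longrightarrow> ext1_vanishes A (\<Omega> k) (\<Omega> j))"

definition Gr ::
    "('k, 'o, 'm) linear_cat \<Rightarrow> ('k, 'g \<Rightarrow> 'o, 'g \<Rightarrow> 'm) linear_cat" where
  "Gr A = \<lparr>Ob = {M. \<forall>k. M k \<in> Ob A},
     Hom = (\<lambda>M N. \<lparr>carrier = {f. \<forall>k. f k \<in> hom_set A (M k) (N k)},
        monoid.mult = undefined, one = undefined,
        ring.zero = (\<lambda>k. \<zero>\<^bsub>Hom A (M k) (N k)\<^esub>),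
        add = (\<lambda>f g k. f k \<oplus>\<^bsub>Hom A (M k) (N k)\<^esub> g k),
        smult = (\<lambda>a f k. a \<odot>\<^bsub>Hom A (M k) (N k)\<^esub> f k)\<rparr>),
     ident = (\<lambda>M k. ident A (M k)),
     comp = (\<lambda>g f k. g k \<cdot>\<^bsub>A\<^esub> f k)\<rparr>"

definition zero_family :: "('k, 'o, 'm) linear_cat \<Rightarrow> ('g \<Rightarrow> 'o) \<Rightarrow> bool" where
  "zero_family A M \<longleftrightarrow> (\<forall>k. zero_object A (M k))"

definition cat_M ::
    "('k, 'o, 'm) linear_cat \<Rightarrow> ('g::linorder \<Rightarrow> 'o set \<times> 'o set) \<Rightarrow> ('g \<Rightarrow> 'o) set" where
  "cat_M A \<Gamma> = {M \<in> Ob (Gr A). zero_family A M \<or>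
     (\<forall>k. \<not> zero_object A (M k) \<and> M k \<in> fst (\<Gamma> k) \<and> (\<forall>j. j > k \<longrightarrow> M k \<notin> fst (\<Gamma> j)))}"

definition cat_N ::
    "('k, 'o, 'm) linear_cat \<Rightarrow> ('g::linorder \<Rightarrow> 'o set \<times> 'o set) \<Rightarrow> ('g \<Rightarrow> 'o) set" where
  "cat_N A \<Gamma> = {N \<in> Ob (Gr A). zero_family A N \<or>
     (\<forall>k. \<not> zero_object A (N k) \<and> N k \<in> snd (\<Gamma> k) \<and> (\<forall>j. j < k \<longrightarrow> N k \<notin> snd (\<Gamma> j)))}"

text \<open>Intersecting with \<open>Ob A\<close> makes the intersection over an empty set of indices equal to \<open>Ob A\<close>.\<close>

definition F_above ::
    "('k, 'o, 'm) linear_cat \<Rightarrow> ('g::linorder \<Rightarrow> 'o set \<times> 'o set) \<Rightarrow> 'g \<Rightarrow> 'o set" where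
  "F_above A \<Gamma> k = Ob A \<inter> (\<Inter>j\<in>{k<..}. snd (\<Gamma> j))"

definition T_below ::
    "('k, 'o, 'm) linear_cat \<Rightarrow> ('g::linorder \<Rightarrow> 'o set \<times> 'o set) \<Rightarrow> 'g \<Rightarrow> 'o set" where
  "T_below A \<Gamma> k = Ob A \<inter> (\<Inter>j\<in>{..<k}. fst (\<Gamma> j))"

definition frak_F ::
    "('k, 'o, 'm) linear_cat \<Rightarrow> ('g::linorder \<Rightarrow> 'o set \<times> 'o set) \<Rightarrow> 'g \<Rightarrow> ('g \<Rightarrow> 'o) \<Rightarrow> 'o" where
  "frak_F A \<Gamma> k M = torsion_free_part A (left_perp A (F_above A \<Gamma> k)) (F_above A \<Gamma> k) (M k)"

definition frak_T ::
    "('k, 'o, 'm) linear_cat \<Rightarrow> ('g::linorder \<Rightarrow> 'o set \<times> 'o set) \<Rightarrow> 'g \<Rightarrow> ('g \<Rightarrow> 'o) \<Rightarrow> 'o" where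
  "frak_T A \<Gamma> k N = torsion_part A (T_below A \<Gamma> k) (right_perp A (T_below A \<Gamma> k)) (N k)"

definition M_dagger ::
    "('k, 'o, 'm) linear_cat \<Rightarrow> ('g::linorder \<Rightarrow> 'o set \<times> 'o set) \<Rightarrow> ('g \<Rightarrow> 'o) set" where
  "M_dagger A \<Gamma> = {M \<in> cat_M A \<Gamma>. \<not> zero_family A M \<and>
     (\<forall>k j. k \<ge> j \<longrightarrow> ext1_vanishes A (M k) (frak_F A \<Gamma> j M))}"

definition N_dagger ::
    "('k, 'o, 'm) linear_cat \<Rightarrow> ('g::linorder \<Rightarrow> 'o set \<times> 'o set) \<Rightarrow> ('g \<Rightarrow> 'o) set" where
  "N_dagger A \<Gamma> = {N \<in> cat_N A \<Gamma>. \<not> zero_family A N \<and>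
     (\<forall>k j. k \<ge> j \<longrightarrow> ext1_vanishes A (frak_T A \<Gamma> k N) (N j))}"

end

theory Submission
  imports Defs
begin

text \<open>
  In both parts the family \<open>\<Omega>\<close> itself serves as \<open>M\<^sub>\<bullet>\<close> and as \<open>N\<^sub>\<bullet>\<close>. For the first part let
  \<open>\<F>\<^sub>k = {\<Omega>\<^sub>j | j \<ge> k}\<^sup>\<bottom>\<close> and \<open>\<T>\<^sub>k = \<^sup>\<bottom>\<F>\<^sub>k\<close>; then \<open>\<Omega>\<^sub>k\<close> lies in \<open>\<T>\<^sub>k\<close> and, as there are no maps from
  \<open>\<Omega>\<^sub>j\<close> to \<open>\<Omega>\<^sub>k\<close> for \<open>j > k\<close>, also in every \<open>\<F>\<^sub>j\<close> with \<open>j > k\<close>. Hence the inclusions are strict and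
  the torsion-free part of \<open>\<Omega>\<^sub>k\<close> is \<open>\<Omega>\<^sub>k\<close>, so the \<open>Ext\<close> conditions are those on \<open>\<Omega>\<close>. The second part is
  dual, with \<open>\<T>'\<^sub>k = \<^sup>\<bottom>{\<Omega>\<^sub>j | j \<le> k}\<close>.
\<close>

section \<open>Additive categories\<close>

context linear_category
begin

text \<open>Hom-sets of different pairs of objects may overlap, so a bare \<open>f\<close> does not
  determine its source and target. Bundling the three memberships lets the composition rules chain
  without separate side conditions on objects.\<close>

definition arr :: "'m \<Rightarrow> 'o \<Rightarrow> 'o \<Rightarrow> bool" where
  "arr f X Y \<longleftrightarrow> X \<in> Ob A \<and> Y \<in> Ob A \<and> f \<in> hom_set A X Y"

abbreviation compose :: "'m \<Rightarrow> 'm \<Rightarrow> 'm"  (infixl "\<bullet>" 70) where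
  "g \<bullet> f \<equiv> g \<cdot>\<^bsub>A\<^esub> f"

abbreviation zero_arr :: "'o \<Rightarrow> 'o \<Rightarrow> 'm" where
  "zero_arr X Y \<equiv> \<zero>\<^bsub>Hom A X Y\<^esub>"

section \<open>Arithmetic of arrows in a linear category\<close>

lemma hom_group: "X \<in> Ob A \<Longrightarrow> Y \<in> Ob A \<Longrightarrow> abelian_group (Hom A X Y)"
  using hom_module module.axioms(2) by blast

lemma arr_dom: "arr f X Y \<Longrightarrow> X \<in> Ob A"
  and arr_cod: "arr f X Y \<Longrightarrow> Y \<in> Ob A"
  and arr_hom: "arr f X Y \<Longrightarrow> f \<in> hom_set A X Y"
  by (auto simp: arr_def)

lemma arr_comp [intro]: "arr f X Y \<Longrightarrow> arr g Y Z \<Longrightarrow> arr (g \<bullet> f) X Z"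
  by (auto simp: arr_def intro: comp_closed)

lemma arr_ident [intro]: "X \<in> Ob A \<Longrightarrow> arr (ident A X) X X"
  by (auto simp: arr_def ident_closed)

lemma arr_zero [intro]: "X \<in> Ob A \<Longrightarrow> Y \<in> Ob A \<Longrightarrow> arr (zero_arr X Y) X Y"
  by (simp add: arr_def abelian_group.axioms abelian_monoid.zero_closed hom_group)

lemma arr_add [intro]: "arr f X Y \<Longrightarrow> arr g X Y \<Longrightarrow> arr (f \<oplus>\<^bsub>Hom A X Y\<^esub> g) X Y"
  by (simp add: arr_def abelian_group.axioms abelian_monoid.a_closed hom_group)

lemma arr_diff [intro]: "arr f X Y \<Longrightarrow> arr g X Y \<Longrightarrow> arr (f \<ominus>\<^bsub>Hom A X Y\<^esub> g) X Y"
  by (simp add: arr_def abelian_group.minus_closed hom_group)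

lemma assoc: "arr f W X \<Longrightarrow> arr g X Y \<Longrightarrow> arr h Y Z \<Longrightarrow> (h \<bullet> g) \<bullet> f = h \<bullet> (g \<bullet> f)"
  by (auto simp: arr_def intro: comp_assoc)

lemma ident_right: "arr f X Y \<Longrightarrow> f \<bullet> ident A X = f"
  and ident_left: "arr f X Y \<Longrightarrow> ident A Y \<bullet> f = f"
  by (auto simp: arr_def comp_ident_left comp_ident_right)

text \<open>The zero arrow equals \<open>\<zero>\<close> times itself; linearity moves this scalar
  out of the composite, and \<open>\<zero>\<close> times any arrow vanishes.\<close>

lemma zero_right: assumes "arr g Y Z" "W \<in> Ob A" shows "g \<bullet> zero_arr W Y = zero_arr W Z"
proof -
  have z: "arr (zero_arr W Y) W Y" using assms by (auto simp: arr_dom)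
  have "g \<bullet> zero_arr W Y = g \<bullet> (\<zero> \<odot>\<^bsub>Hom A W Y\<^esub> zero_arr W Y)"
    using z by (simp add: arr_def hom_module module.smult_l_null)
  also have "\<dots> = \<zero> \<odot>\<^bsub>Hom A W Z\<^esub> (g \<bullet> zero_arr W Y)"
    using assms z by (intro comp_smult_right) (auto simp: arr_def)
  also have "\<dots> = zero_arr W Z"
    using arr_comp[OF z assms(1)] by (simp add: arr_def hom_module module.smult_l_null)
  finally show ?thesis .
qed

lemma zero_left: assumes "arr f X Y" "Z \<in> Ob A" shows "zero_arr Y Z \<bullet> f = zero_arr X Z"
proof -
  have z: "arr (zero_arr Y Z) Y Z" using assms by (auto simp: arr_cod)
  have "zero_arr Y Z \<bullet> f = (\<zero> \<odot>\<^bsub>Hom A Y Z\<^esub> zero_arr Y Z) \<bullet> f"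
    using z by (simp add: arr_def hom_module module.smult_l_null)
  also have "\<dots> = \<zero> \<odot>\<^bsub>Hom A X Z\<^esub> (zero_arr Y Z \<bullet> f)"
    using assms z by (intro comp_smult_left) (auto simp: arr_def)
  also have "\<dots> = zero_arr X Z"
    using arr_comp[OF assms(1) z] by (simp add: arr_def hom_module module.smult_l_null)
  finally show ?thesis .
qed

lemma add_right: "arr f X Y \<Longrightarrow> arr f' X Y \<Longrightarrow> arr g Y Z \<Longrightarrow>
    g \<bullet> (f \<oplus>\<^bsub>Hom A X Y\<^esub> f') = (g \<bullet> f) \<oplus>\<^bsub>Hom A X Z\<^esub> (g \<bullet> f')"
  by (auto simp: arr_def intro: comp_add_right)

lemma add_left: "arr f X Y \<Longrightarrow> arr g Y Z \<Longrightarrow> arr g' Y Z \<Longrightarrow>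
    (g \<oplus>\<^bsub>Hom A Y Z\<^esub> g') \<bullet> f = (g \<bullet> f) \<oplus>\<^bsub>Hom A X Z\<^esub> (g' \<bullet> f)"
  by (auto simp: arr_def intro: comp_add_left)

lemma add_zero_right: "arr f X Y \<Longrightarrow> f \<oplus>\<^bsub>Hom A X Y\<^esub> zero_arr X Y = f"
  and add_zero_left: "arr f X Y \<Longrightarrow> zero_arr X Y \<oplus>\<^bsub>Hom A X Y\<^esub> f = f"
  using abelian_group.axioms(1)[OF hom_group]
  by (auto simp: arr_def abelian_monoid.r_zero abelian_monoid.l_zero)

lemma diff_add: assumes "arr f X Y" "arr g X Y"
  shows "(f \<ominus>\<^bsub>Hom A X Y\<^esub> g) \<oplus>\<^bsub>Hom A X Y\<^esub> g = f"
proof -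
  interpret V: abelian_group "Hom A X Y" using assms by (simp add: arr_def hom_group)
  show ?thesis using assms by (simp add: arr_def a_minus_def V.a_assoc V.l_neg)
qed

lemma add_cancel: assumes "arr f X Y" "arr g X Y" "arr h X Y"
    and "f \<oplus>\<^bsub>Hom A X Y\<^esub> h = g \<oplus>\<^bsub>Hom A X Y\<^esub> h"
  shows "f = g"
proof -
  interpret V: abelian_group "Hom A X Y" using assms by (simp add: arr_def hom_group)
  show ?thesis using assms by (simp add: arr_def)
qed

lemma diff_eq_zero: assumes "arr f X Y" "arr g X Y" "f \<ominus>\<^bsub>Hom A X Y\<^esub> g = zero_arr X Y"
  shows "f = g"
  using diff_add[OF assms(1,2)] assms add_zero_left by simp

lemma diff_self: assumes "arr f X Y" shows "f \<ominus>\<^bsub>Hom A X Y\<^esub> f = zero_arr X Y"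
proof -
  interpret V: abelian_group "Hom A X Y" using assms by (simp add: arr_def hom_group)
  show ?thesis using assms by (simp add: arr_def a_minus_def V.r_neg)
qed

text \<open>Composition is additive by assumption; adding \<open>g \<bullet> f'\<close> to both
  sides reduces differences to sums.\<close>

lemma diff_right: assumes "arr f X Y" "arr f' X Y" "arr g Y Z"
  shows "g \<bullet> (f \<ominus>\<^bsub>Hom A X Y\<^esub> f') = (g \<bullet> f) \<ominus>\<^bsub>Hom A X Z\<^esub> (g \<bullet> f')"
proof (rule add_cancel)
  show "g \<bullet> (f \<ominus>\<^bsub>Hom A X Y\<^esub> f') \<oplus>\<^bsub>Hom A X Z\<^esub> (g \<bullet> f')
      = (g \<bullet> f) \<ominus>\<^bsub>Hom A X Z\<^esub> (g \<bullet> f') \<oplus>\<^bsub>Hom A X Z\<^esub> (g \<bullet> f')"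
    using add_right[OF arr_diff[OF assms(1,2)] assms(2,3)]
    unfolding diff_add[OF assms(1,2)] diff_add[OF arr_comp[OF assms(1,3)] arr_comp[OF assms(2,3)]]
    by simp
qed (use assms in blast)+

lemma diff_left: assumes "arr f X Y" "arr g Y Z" "arr g' Y Z"
  shows "(g \<ominus>\<^bsub>Hom A Y Z\<^esub> g') \<bullet> f = (g \<bullet> f) \<ominus>\<^bsub>Hom A X Z\<^esub> (g' \<bullet> f)"
proof (rule add_cancel)
  show "(g \<ominus>\<^bsub>Hom A Y Z\<^esub> g') \<bullet> f \<oplus>\<^bsub>Hom A X Z\<^esub> (g' \<bullet> f)
      = (g \<bullet> f) \<ominus>\<^bsub>Hom A X Z\<^esub> (g' \<bullet> f) \<oplus>\<^bsub>Hom A X Z\<^esub> (g' \<bullet> f)"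
    using add_left[OF assms(1) arr_diff[OF assms(2,3)] assms(3)]
    unfolding diff_add[OF assms(2,3)] diff_add[OF arr_comp[OF assms(1,2)] arr_comp[OF assms(1,3)]]
    by simp
qed (use assms in blast)+

section \<open>Monomorphisms, epimorphisms, kernels and cokernels, tested against zero\<close>

lemma mono_iff: "monomorphism A X Y f \<longleftrightarrow>
    arr f X Y \<and> (\<forall>W h. arr h W X \<longrightarrow> f \<bullet> h = zero_arr W Y \<longrightarrow> h = zero_arr W X)"
    (is "_ \<longleftrightarrow> ?R")
proof
  assume m: "monomorphism A X Y f"
  then have f: "arr f X Y" by (simp add: monomorphism_def arr_def)
  moreover have "h = zero_arr W X" if h: "arr h W X" "f \<bullet> h = zero_arr W Y" for W h
  proof -
    have "arr (zero_arr W X) W X" "f \<bullet> h = f \<bullet> zero_arr W X"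
      using f h by (auto simp: zero_right arr_dom arr_cod)
    then show ?thesis using m h unfolding monomorphism_def arr_def by blast
  qed
  ultimately show ?R by blast
next
  assume R: ?R
  then have f: "arr f X Y" by blast
  have "g = h" if "arr g W X" "arr h W X" "f \<bullet> g = f \<bullet> h" for W g h
  proof -
    \<comment> \<open>Equal composites mean that \<open>f\<close> kills the difference, to which the
      test against zero applies.\<close>
    have "f \<bullet> (g \<ominus>\<^bsub>Hom A W X\<^esub> h) = zero_arr W Y"
      using diff_right[OF that(1,2) f] diff_self[OF arr_comp[OF that(2) f]] that(3) by simp
    then show ?thesis using R arr_diff[OF that(1,2)] diff_eq_zero[OF that(1,2)] by blast
  qed
  then show "monomorphism A X Y f" using f by (auto simp: monomorphism_def arr_def)
qed

lemma epi_iff: "epimorphism A X Y f \<longleftrightarrow>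
    arr f X Y \<and> (\<forall>W h. arr h Y W \<longrightarrow> h \<bullet> f = zero_arr X W \<longrightarrow> h = zero_arr Y W)"
    (is "_ \<longleftrightarrow> ?R")
proof
  assume m: "epimorphism A X Y f"
  then have f: "arr f X Y" by (simp add: epimorphism_def arr_def)
  moreover have "h = zero_arr Y W" if h: "arr h Y W" "h \<bullet> f = zero_arr X W" for W h
  proof -
    have "arr (zero_arr Y W) Y W" "h \<bullet> f = zero_arr Y W \<bullet> f"
      using f h by (auto simp: zero_left arr_dom arr_cod)
    then show ?thesis using m h unfolding epimorphism_def arr_def by blast
  qed
  ultimately show ?R by blast
next
  assume R: ?R
  then have f: "arr f X Y" by blast
  have "g = h" if "arr g Y W" "arr h Y W" "g \<bullet> f = h \<bullet> f" for W g h
  proof -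
    have "(g \<ominus>\<^bsub>Hom A Y W\<^esub> h) \<bullet> f = zero_arr X W"
      using diff_left[OF f that(1,2)] diff_self[OF arr_comp[OF f that(2)]] that(3) by simp
    then show ?thesis using R arr_diff[OF that(1,2)] diff_eq_zero[OF that(1,2)] by blast
  qed
  then show "epimorphism A X Y f" using f by (auto simp: epimorphism_def arr_def)
qed

lemma monoD: "monomorphism A X Y f \<Longrightarrow> arr h W X \<Longrightarrow> f \<bullet> h = zero_arr W Y \<Longrightarrow> h = zero_arr W X"
  and epiD: "epimorphism A X Y e \<Longrightarrow> arr g Y W \<Longrightarrow> g \<bullet> e = zero_arr X W \<Longrightarrow> g = zero_arr Y W"
  and mono_arr: "monomorphism A X Y f \<Longrightarrow> arr f X Y"
  and epi_arr: "epimorphism A X Y e \<Longrightarrow> arr e X Y"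
  by (auto simp: mono_iff epi_iff)

lemma mono_cancel: "monomorphism A X Y f \<Longrightarrow> arr g W X \<Longrightarrow> arr h W X \<Longrightarrow> f \<bullet> g = f \<bullet> h \<Longrightarrow> g = h"
  and epi_cancel: "epimorphism A X Y e \<Longrightarrow> arr g Y W \<Longrightarrow> arr h Y W \<Longrightarrow> g \<bullet> e = h \<bullet> e \<Longrightarrow> g = h"
  unfolding monomorphism_def epimorphism_def arr_def by blast+

text \<open>Splits unique factorisation into cancellation and bare existence: uniqueness for the
  zero map makes \<open>i\<close> mono, and conversely a mono \<open>i\<close> makes any
  factorisation unique.\<close>

lemma kernel_iff: "is_kernel A N X Y i f \<longleftrightarrow>
    monomorphism A N X i \<and> arr f X Y \<and> f \<bullet> i = zero_arr N Y \<and>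
    (\<forall>W h. arr h W X \<longrightarrow> f \<bullet> h = zero_arr W Y \<longrightarrow> (\<exists>u. arr u W N \<and> i \<bullet> u = h))"
    (is "_ \<longleftrightarrow> ?R")
proof
  assume k: "is_kernel A N X Y i f"
  then have i: "arr i N X" and f: "arr f X Y" and z: "f \<bullet> i = zero_arr N Y"
    by (auto simp: is_kernel_def arr_def)
  have ex1: "\<exists>!u. u \<in> hom_set A W N \<and> i \<bullet> u = h"
    if "arr h W X" "f \<bullet> h = zero_arr W Y" for W h
    using k that by (auto simp: is_kernel_def arr_def)
  have "h = zero_arr W N" if h: "arr h W N" "i \<bullet> h = zero_arr W X" for W h
  proof -
    have W: "W \<in> Ob A" "N \<in> Ob A" "X \<in> Ob A" using h i by (auto simp: arr_def)
    have "\<exists>!u. u \<in> hom_set A W N \<and> i \<bullet> u = zero_arr W X"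
      using ex1[of "zero_arr W X" W] W f by (auto simp: zero_right)
    then show ?thesis using h zero_right[OF i W(1)] arr_zero[OF W(1,2)] arr_hom by blast
  qed
  then have "monomorphism A N X i" using i by (simp add: mono_iff)
  moreover have "\<exists>u. arr u W N \<and> i \<bullet> u = h" if "arr h W X" "f \<bullet> h = zero_arr W Y" for W h
    using ex1[OF that] that i by (auto simp: arr_def)
  ultimately show ?R using f z by blast
next
  assume R: ?R
  then have m: "monomorphism A N X i" and i: "arr i N X" and f: "arr f X Y"
    and z: "f \<bullet> i = zero_arr N Y"
    by (auto intro: mono_arr)
  have "\<exists>!u. u \<in> hom_set A W N \<and> i \<bullet> u = h"
    if W: "W \<in> Ob A" and h: "h \<in> hom_set A W X" "f \<bullet> h = zero_arr W Y" for W h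
  proof -
    have "arr h W X" using W h(1) arr_dom[OF f] by (simp add: arr_def)
    then obtain u where u: "arr u W N" "i \<bullet> u = h" using R h(2) by blast
    moreover have "v = u" if "v \<in> hom_set A W N" "i \<bullet> v = h" for v
      using mono_cancel[OF m _ u(1), of v] that u(2) W arr_dom[OF i] by (simp add: arr_def)
    ultimately show ?thesis using arr_hom by blast
  qed
  then show "is_kernel A N X Y i f"
    using i f z by (simp add: is_kernel_def arr_def)
qed

lemma cokernel_iff: "is_cokernel A X Y C f p \<longleftrightarrow>
    epimorphism A Y C p \<and> arr f X Y \<and> p \<bullet> f = zero_arr X C \<and>
    (\<forall>W h. arr h Y W \<longrightarrow> h \<bullet> f = zero_arr X W \<longrightarrow> (\<exists>u. arr u C W \<and> u \<bullet> p = h))"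
    (is "_ \<longleftrightarrow> ?R")
proof
  assume k: "is_cokernel A X Y C f p"
  then have p: "arr p Y C" and f: "arr f X Y" and z: "p \<bullet> f = zero_arr X C"
    by (auto simp: is_cokernel_def arr_def)
  have ex1: "\<exists>!u. u \<in> hom_set A C W \<and> u \<bullet> p = h"
    if "arr h Y W" "h \<bullet> f = zero_arr X W" for W h
    using k that by (auto simp: is_cokernel_def arr_def)
  have "h = zero_arr C W" if h: "arr h C W" "h \<bullet> p = zero_arr Y W" for W h
  proof -
    have W: "W \<in> Ob A" "C \<in> Ob A" "Y \<in> Ob A" using h p by (auto simp: arr_def)
    have "\<exists>!u. u \<in> hom_set A C W \<and> u \<bullet> p = zero_arr Y W"
      using ex1[of "zero_arr Y W" W] W f by (auto simp: zero_left)
    then show ?thesis using h zero_left[OF p W(1)] arr_zero[OF W(2,1)] arr_hom by blast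
  qed
  then have "epimorphism A Y C p" using p by (simp add: epi_iff)
  moreover have "\<exists>u. arr u C W \<and> u \<bullet> p = h" if "arr h Y W" "h \<bullet> f = zero_arr X W" for W h
    using ex1[OF that] that p by (auto simp: arr_def)
  ultimately show ?R using f z by blast
next
  assume R: ?R
  then have m: "epimorphism A Y C p" and p: "arr p Y C" and f: "arr f X Y"
    and z: "p \<bullet> f = zero_arr X C"
    by (auto intro: epi_arr)
  have "\<exists>!u. u \<in> hom_set A C W \<and> u \<bullet> p = h"
    if W: "W \<in> Ob A" and h: "h \<in> hom_set A Y W" "h \<bullet> f = zero_arr X W" for W h
  proof -
    have "arr h Y W" using W h(1) arr_cod[OF f] by (simp add: arr_def)
    then obtain u where u: "arr u C W" "u \<bullet> p = h" using R h(2) by blast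
    moreover have "v = u" if "v \<in> hom_set A C W" "v \<bullet> p = h" for v
      using epi_cancel[OF m _ u(1), of v] that u(2) W arr_cod[OF p] by (simp add: arr_def)
    ultimately show ?thesis using arr_hom by blast
  qed
  then show "is_cokernel A X Y C f p"
    using p f z by (simp add: is_cokernel_def arr_def)
qed

lemma kernelD:
  assumes "is_kernel A N X Y i f"
  shows "monomorphism A N X i" "arr i N X" "arr f X Y" "f \<bullet> i = zero_arr N Y"
  using assms by (auto simp: kernel_iff mono_arr)

lemma cokernelD:
  assumes "is_cokernel A X Y C f p"
  shows "epimorphism A Y C p" "arr f X Y" "arr p Y C" "p \<bullet> f = zero_arr X C"
  using assms by (auto simp: cokernel_iff epi_arr)

lemma kernel_factor:
  assumes "is_kernel A N X Y i f" "arr h W X" "f \<bullet> h = zero_arr W Y"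
  obtains u where "arr u W N" "i \<bullet> u = h"
  using assms by (auto simp: kernel_iff)

lemma cokernel_factor:
  assumes "is_cokernel A X Y C f p" "arr h Y W" "h \<bullet> f = zero_arr X W"
  obtains u where "arr u C W" "u \<bullet> p = h"
  using assms by (auto simp: cokernel_iff)

section \<open>Zero objects and isomorphisms\<close>

lemma zero_object_iff: "zero_object A Z \<longleftrightarrow> Z \<in> Ob A \<and> ident A Z = zero_arr Z Z"
proof (cases "Z \<in> Ob A")
  case Z: True
  show ?thesis
  proof
    assume "zero_object A Z"
    then show "Z \<in> Ob A \<and> ident A Z = zero_arr Z Z"
      using arr_ident[OF Z] arr_zero[OF Z Z] by (auto simp: zero_object_def arr_def)
  next
    assume R: "Z \<in> Ob A \<and> ident A Z = zero_arr Z Z"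
    have "\<exists>!f. f \<in> hom_set A X Z" if X: "X \<in> Ob A" for X
    proof -
      have "f = zero_arr X Z" if "f \<in> hom_set A X Z" for f
        using ident_left[of f X Z] zero_left[of f X Z Z] R X that by (simp add: arr_def)
      then show ?thesis using arr_zero[OF X Z] arr_hom by blast
    qed
    moreover have "\<exists>!f. f \<in> hom_set A Z X" if X: "X \<in> Ob A" for X
    proof -
      have "f = zero_arr Z X" if "f \<in> hom_set A Z X" for f
        using ident_right[of f Z X] zero_right[of f Z X Z] R X that by (simp add: arr_def)
      then show ?thesis using arr_zero[OF Z X] arr_hom by blast
    qed
    ultimately show "zero_object A Z" using Z by (simp add: zero_object_def)
  qed
qed (simp add: zero_object_def)

lemma to_zero_object: "zero_object A Z \<Longrightarrow> arr f X Z \<Longrightarrow> f = zero_arr X Z"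
  and from_zero_object: "zero_object A Z \<Longrightarrow> arr g Z X \<Longrightarrow> g = zero_arr Z X"
  using ident_left[of f X Z] zero_left[of f X Z Z] ident_right[of g Z X] zero_right[of g Z X Z]
  by (simp_all add: zero_object_iff arr_cod arr_dom)

lemma iso_iff: "isomorphism A X Y f \<longleftrightarrow>
    arr f X Y \<and> (\<exists>g. arr g Y X \<and> g \<bullet> f = ident A X \<and> f \<bullet> g = ident A Y)"
  by (auto simp: isomorphism_def arr_def)

lemma isoE:
  assumes "isomorphism A X Y f"
  obtains g where "arr f X Y" "arr g Y X" "g \<bullet> f = ident A X" "f \<bullet> g = ident A Y"
    "isomorphism A Y X g"
  using assms by (auto simp: iso_iff)

lemma iso_mono_epi: assumes "isomorphism A X Y f"
  shows "monomorphism A X Y f" "epimorphism A X Y f"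
proof -
  obtain g where g: "arr f X Y" "arr g Y X" "g \<bullet> f = ident A X" "f \<bullet> g = ident A Y"
    by (rule isoE[OF assms])
  have "h = zero_arr W X" if "arr h W X" "f \<bullet> h = zero_arr W Y" for W h
    using assoc[OF that(1) g(1,2)] that g ident_left[OF that(1)]
      zero_right[OF g(2) arr_dom[OF that(1)]] by simp
  then show "monomorphism A X Y f" using g by (simp add: mono_iff)
  have "h = zero_arr Y W" if "arr h Y W" "h \<bullet> f = zero_arr X W" for W h
    using assoc[OF g(2,1) that(1)] that g ident_right[OF that(1)]
      zero_left[OF g(2) arr_cod[OF that(1)]] by simp
  then show "epimorphism A X Y f" using g by (simp add: epi_iff)
qed

lemma isomorphic_sym: "isomorphic A X Y \<Longrightarrow> isomorphic A Y X"
  unfolding isomorphic_def by (meson isoE)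

lemma ident_iso: "X \<in> Ob A \<Longrightarrow> isomorphism A X X (ident A X)"
  using arr_ident ident_left[OF arr_ident] unfolding iso_iff by blast

lemma mono_comp: assumes "monomorphism A X Y f" "monomorphism A Y Z g"
  shows "monomorphism A X Z (g \<bullet> f)"
proof -
  have a: "arr f X Y" "arr g Y Z" using assms by (auto simp: mono_arr)
  have "h = zero_arr W X" if h: "arr h W X" "g \<bullet> f \<bullet> h = zero_arr W Z" for W h
    using assoc[OF h(1) a] h monoD[OF assms(2) arr_comp[OF h(1) a(1)]] monoD[OF assms(1) h(1)]
    by simp
  then show ?thesis using a by (auto simp: mono_iff)
qed

lemma mono_factor: assumes "monomorphism A X Z (g \<bullet> f)" "arr f X Y" "arr g Y Z"
  shows "monomorphism A X Y f"
proof -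
  have "h = zero_arr W X" if h: "arr h W X" "f \<bullet> h = zero_arr W Y" for W h
    using assoc[OF h(1) assms(2,3)] h monoD[OF assms(1) h(1)]
      zero_right[OF assms(3) arr_dom[OF h(1)]] by simp
  then show ?thesis using assms by (auto simp: mono_iff)
qed

section \<open>Vanishing hom-spaces and perpendicular classes\<close>

lemma hom_zero_iff: "X \<in> Ob A \<Longrightarrow> Y \<in> Ob A \<Longrightarrow>
    hom_zero A X Y \<longleftrightarrow> (\<forall>f. arr f X Y \<longrightarrow> f = zero_arr X Y)"
  using arr_zero[of X Y] by (auto simp: hom_zero_def arr_def)

lemma left_perp_iff: "C \<subseteq> Ob A \<Longrightarrow> M \<in> left_perp A C \<longleftrightarrow>
    M \<in> Ob A \<and> (\<forall>X\<in>C. \<forall>f. arr f M X \<longrightarrow> f = zero_arr M X)"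
  by (auto simp: left_perp_def hom_zero_iff subset_iff)

lemma right_perp_iff: "C \<subseteq> Ob A \<Longrightarrow> M \<in> right_perp A C \<longleftrightarrow>
    M \<in> Ob A \<and> (\<forall>X\<in>C. \<forall>f. arr f X M \<longrightarrow> f = zero_arr X M)"
  by (auto simp: right_perp_def hom_zero_iff subset_iff)

lemma perp_subset: "left_perp A C \<subseteq> Ob A" "right_perp A C \<subseteq> Ob A"
  by (auto simp: left_perp_def right_perp_def)

lemma subset_right_left_perp: "C \<subseteq> Ob A \<Longrightarrow> C \<subseteq> right_perp A (left_perp A C)"
  and subset_left_right_perp: "C \<subseteq> Ob A \<Longrightarrow> C \<subseteq> left_perp A (right_perp A C)"
  by (auto simp: left_perp_def right_perp_def)

text \<open>An isomorphism from \<open>X\<close> to \<open>Y\<close> is epi, so a map out of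
  \<open>Y\<close> is zero as soon as its composite out of \<open>X\<close> is.\<close>

lemma full_left_perp: assumes C: "C \<subseteq> Ob A" shows "full_subcategory A (left_perp A C)"
proof -
  have "Y \<in> left_perp A C" if X: "X \<in> left_perp A C" and XY: "isomorphic A X Y" for X Y
  proof -
    obtain f where f: "isomorphism A X Y f" using XY by (auto simp: isomorphic_def)
    then have e: "epimorphism A X Y f" and a: "arr f X Y" by (auto simp: iso_mono_epi iso_iff)
    have "g = zero_arr Y Z" if "Z \<in> C" "arr g Y Z" for Z g
      using epiD[OF e that(2)] X that arr_comp[OF a that(2)] by (auto simp: left_perp_iff[OF C])
    then show ?thesis using a by (auto simp: left_perp_iff[OF C] arr_cod)
  qed
  then show ?thesis using perp_subset by (auto simp: full_subcategory_def)
qed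

lemma full_right_perp: assumes C: "C \<subseteq> Ob A" shows "full_subcategory A (right_perp A C)"
proof -
  have "Y \<in> right_perp A C" if X: "X \<in> right_perp A C" and XY: "isomorphic A X Y" for X Y
  proof -
    \<comment> \<open>The isomorphism is taken from \<open>Y\<close> to \<open>X\<close>, because
      maps into \<open>Y\<close> must be continued to \<open>X\<close>.\<close>
    obtain f where f: "isomorphism A Y X f"
      using isomorphic_sym[OF XY] by (auto simp: isomorphic_def)
    then have e: "monomorphism A Y X f" and a: "arr f Y X" by (auto simp: iso_mono_epi iso_iff)
    have "g = zero_arr Z Y" if "Z \<in> C" "arr g Z Y" for Z g
      using monoD[OF e that(2)] X that arr_comp[OF that(2) a] by (auto simp: right_perp_iff[OF C])
    then show ?thesis using a by (auto simp: right_perp_iff[OF C] arr_dom)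
  qed
  then show ?thesis using perp_subset by (auto simp: full_subcategory_def)
qed

end

section \<open>Abelian categories\<close>

context abelian_length_category
begin

text \<open>A mono is the kernel of its own cokernel: \<open>f\<close> is the kernel of some
  \<open>g\<close>, and \<open>g\<close> factors through \<open>p\<close>, so whatever
  \<open>p\<close> kills is killed by \<open>g\<close> and factors through \<open>f\<close>.\<close>

lemma mono_short_exact:
  assumes "monomorphism A X Y f" "is_cokernel A X Y C f p"
  shows "short_exact A X Y C f p"
proof -
  obtain Z g where g: "is_kernel A X Y Z f g" using mono_is_kernel[OF assms(1)] by blast
  note p = cokernelD[OF assms(2)]
  obtain g' where g': "arr g' C Z" "g' \<bullet> p = g"
    by (rule cokernel_factor[OF assms(2) kernelD(3,4)[OF g]])
  have "\<exists>u. arr u W X \<and> f \<bullet> u = h" if h: "arr h W Y" "p \<bullet> h = zero_arr W C" for W h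
  proof -
    have "g \<bullet> h = zero_arr W Z"
      using assoc[OF h(1) p(3) g'(1)] g'(2) h zero_right[OF g'(1) arr_dom[OF h(1)]] by simp
    then show ?thesis using kernel_factor[OF g h(1)] by blast
  qed
  then show ?thesis using assms p by (simp add: short_exact_def kernel_iff)
qed

lemma epi_short_exact:
  assumes "epimorphism A X Y f" "is_kernel A N X Y i f"
  shows "short_exact A N X Y i f"
proof -
  obtain W g where g: "is_cokernel A W X Y g f" using epi_is_cokernel[OF assms(1)] by blast
  note i = kernelD[OF assms(2)]
  obtain g' where g': "arr g' W N" "i \<bullet> g' = g"
    by (rule kernel_factor[OF assms(2) cokernelD(2,4)[OF g]])
  have "\<exists>u. arr u Y V \<and> u \<bullet> f = h" if h: "arr h X V" "h \<bullet> i = zero_arr N V" for V h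
  proof -
    have "h \<bullet> g = zero_arr W V"
      using assoc[OF g'(1) i(2) h(1)] g'(2) h zero_left[OF g'(1) arr_cod[OF h(1)]] by simp
    then show ?thesis using cokernel_factor[OF g h(1)] by blast
  qed
  then show ?thesis using assms i by (simp add: short_exact_def cokernel_iff)
qed

text \<open>Being mono, \<open>f\<close> is the kernel of some \<open>g\<close>, which is zero
  because \<open>f\<close> is epi. Hence the identity of \<open>Y\<close> factors through
  \<open>f\<close>, and cancelling \<open>f\<close> makes this right inverse two-sided.\<close>

lemma mono_epi_iso:
  assumes m: "monomorphism A X Y f" and e: "epimorphism A X Y f"
  shows "isomorphism A X Y f"
proof -
  obtain Z g where g: "is_kernel A X Y Z f g" using mono_is_kernel[OF m] by blast
  note f = kernelD(2)[OF g] and gY = kernelD(3)[OF g]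
  have "g = zero_arr Y Z" using epiD[OF e kernelD(3,4)[OF g]] .
  then have "g \<bullet> ident A Y = zero_arr Y Z" using ident_right[OF gY] by simp
  then obtain u where u: "arr u Y X" "f \<bullet> u = ident A Y"
    using kernel_factor[OF g arr_ident] arr_dom[OF gY] by blast
  have "f \<bullet> (u \<bullet> f) = f \<bullet> ident A X"
    using assoc[OF f u(1) f] u(2) ident_left[OF f] ident_right[OF f] by simp
  then have "u \<bullet> f = ident A X"
    using mono_cancel[OF m] arr_comp[OF f u(1)] arr_ident[OF arr_dom[OF f]] by blast
  then show ?thesis using f u by (auto simp: iso_iff)
qed

section \<open>Completing arrows to exact sequences and pullback squares\<close>

lemma mono_extends_short_exact:
  assumes "monomorphism A X Y f"
  obtains C p where "short_exact A X Y C f p"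
  using mono_short_exact[OF assms] ex_cokernel mono_arr[OF assms] unfolding arr_def by blast

lemma epi_extends_short_exact:
  assumes "epimorphism A X Y f"
  obtains N i where "short_exact A N X Y i f"
  using epi_short_exact[OF assms] ex_kernel epi_arr[OF assms] unfolding arr_def by blast

lemma obtain_kernel:
  assumes "arr f X Y"
  obtains N i where "is_kernel A N X Y i f"
  using ex_kernel assms unfolding arr_def by blast

lemma obtain_cokernel:
  assumes "arr f X Y"
  obtains C p where "is_cokernel A X Y C f p"
  using ex_cokernel assms unfolding arr_def by blast

lemma short_exactD:
  assumes "short_exact A X Y Z i p"
  shows "is_kernel A X Y Z i p" "is_cokernel A X Y Z i p"
    "monomorphism A X Y i" "epimorphism A Y Z p"
    "arr i X Y" "arr p Y Z" "p \<bullet> i = zero_arr X Z"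
  using assms kernelD cokernelD by (auto simp: short_exact_def)

text \<open>\<open>P\<close> is the fibre product, built as the kernel of \<open>d = (q, -h)\<close>
  on the biproduct of \<open>M\<close> and \<open>V\<close>. It replaces the choice of preimages
  under \<open>q\<close> in element-wise diagram chases.\<close>

lemma pullback_epi:
  assumes q: "epimorphism A M Z q" and h: "arr h V Z"
  obtains P a b where "arr a P M" "epimorphism A P V b" "q \<bullet> a = h \<bullet> b"
proof -
  have qa: "arr q M Z" by (rule epi_arr[OF q])
  obtain B iM iV pM pV where "is_biproduct A M V B iM iV pM pV"
    using ex_biproduct arr_dom[OF qa] arr_dom[OF h] by blast
  then have b: "arr iM M B" "arr iV V B" "arr pM B M" "arr pV B V"
      "pM \<bullet> iM = ident A M" "pV \<bullet> iV = ident A V" "pV \<bullet> iM = zero_arr M V"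
    by (auto simp: is_biproduct_def arr_def)
  define d where "d = (q \<bullet> pM) \<ominus>\<^bsub>Hom A B Z\<^esub> (h \<bullet> pV)"
  have qp: "arr (q \<bullet> pM) B Z" and hp: "arr (h \<bullet> pV) B Z" using b qa h by auto
  then have d: "arr d B Z" by (auto simp: d_def)
  have "q \<bullet> pM \<bullet> iM = q" using assoc[OF b(1,3) qa] b(5) ident_right[OF qa] by simp
  moreover have "h \<bullet> pV \<bullet> iM = zero_arr M Z"
    using assoc[OF b(1,4) h] b(7) zero_right[OF h arr_dom[OF qa]] by simp
  ultimately have "d \<bullet> iM = q \<ominus>\<^bsub>Hom A M Z\<^esub> zero_arr M Z"
    using diff_left[OF b(1) qp hp] by (simp add: d_def)
  also have "\<dots> = q"
    using diff_add[OF qa arr_zero[OF arr_dom arr_cod]] qa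
      add_zero_right[OF arr_diff[OF qa arr_zero[OF arr_dom arr_cod]]] by simp
  finally have dq: "d \<bullet> iM = q" .
  have "g = zero_arr Z W" if g: "arr g Z W" "g \<bullet> d = zero_arr B W" for W g
    using epiD[OF q g(1)] assoc[OF b(1) d g(1)] dq g(2) zero_left[OF b(1) arr_cod[OF g(1)]] by simp
  then have "epimorphism A B Z d" using d by (simp add: epi_iff)
  then obtain P j where j: "short_exact A P B Z j d" by (rule epi_extends_short_exact)
  note ja = short_exactD(5)[OF j]
  have "d \<bullet> j = (q \<bullet> (pM \<bullet> j)) \<ominus>\<^bsub>Hom A P Z\<^esub> (h \<bullet> (pV \<bullet> j))"
    using diff_left[OF ja qp hp] assoc[OF ja b(3) qa] assoc[OF ja b(4) h] by (simp add: d_def)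
  then have "q \<bullet> (pM \<bullet> j) = h \<bullet> (pV \<bullet> j)"
    using diff_eq_zero[of "q \<bullet> (pM \<bullet> j)" P Z "h \<bullet> (pV \<bullet> j)"] short_exactD(7)[OF j] ja b qa h
    by (simp add: arr_comp[OF arr_comp])
  moreover have "epimorphism A P V (pV \<bullet> j)"
  proof -
    have "g = zero_arr V W" if g: "arr g V W" "g \<bullet> (pV \<bullet> j) = zero_arr P W" for W g
    proof -
      have gp: "arr (g \<bullet> pV) B W" using b g by auto
      have "g \<bullet> pV \<bullet> j = zero_arr P W" using assoc[OF ja b(4) g(1)] g(2) by simp
      \<comment> \<open>\<open>d\<close> is a cokernel of \<open>j\<close>, so
        \<open>g \<bullet> pV\<close> descends along \<open>d\<close>. On the summand
        \<open>M\<close> the descended map \<open>t\<close> satisfies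
        \<open>t \<bullet> q = 0\<close>, so it is zero; the summand \<open>V\<close> then recovers
        \<open>g\<close>.\<close>
      then obtain t where t: "arr t Z W" "t \<bullet> d = g \<bullet> pV"
        by (rule cokernel_factor[OF short_exactD(2)[OF j] gp])
      have "t \<bullet> q = g \<bullet> pV \<bullet> iM" using assoc[OF b(1) d t(1)] dq t(2) by simp
      also have "\<dots> = zero_arr M W"
        using assoc[OF b(1,4) g(1)] b(7) zero_right[OF g(1) arr_dom[OF qa]] by simp
      finally have "t = zero_arr Z W" by (rule epiD[OF q t(1)])
      then have "g \<bullet> pV = zero_arr B W" using t zero_left[OF d arr_cod[OF g(1)]] by simp
      then have "zero_arr B W \<bullet> iV = g" using assoc[OF b(2,4) g(1)] b(6) ident_right[OF g(1)] by simp
      then show ?thesis using zero_left[OF b(2) arr_cod[OF g(1)]] by simp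
    qed
    then show ?thesis using arr_comp[OF ja b(4)] by (simp add: epi_iff)
  qed
  ultimately show ?thesis using that arr_comp[OF ja b(3)] by blast
qed

subsection \<open>Length of subobjects\<close>

text \<open>A relation rather than a function: nothing has to be shown about different composition
  series of one object having the same length, and inductions can run along a series.\<close>

inductive has_length :: "nat \<Rightarrow> 'o \<Rightarrow> bool" where
  has_length_zero: "zero_object A X \<Longrightarrow> has_length 0 X"
| has_length_Suc: "has_length n X \<Longrightarrow> short_exact A X Y S i p \<Longrightarrow> simple_object A S \<Longrightarrow>
    has_length (Suc n) Y"

lemma obtain_length: assumes "M \<in> Ob A" obtains n where "has_length n M"
proof -
  obtain n :: nat and X i where X: "zero_object A (X 0)" "X n = M"
      "\<forall>l<n. \<exists>S p. simple_object A S \<and> short_exact A (X l) (X (Suc l)) S (i l) p"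
    using all_finite_length[OF assms] unfolding finite_length_def by blast
  have "l \<le> n \<Longrightarrow> has_length l (X l)" for l
  proof (induction l)
    case 0
    then show ?case using X(1) by (simp add: has_length_zero)
  next
    case (Suc l)
    then obtain S p where "simple_object A S" "short_exact A (X l) (X (Suc l)) S (i l) p"
      using X(3) Suc_le_lessD by blast
    then show ?case using Suc has_length_Suc by simp
  qed
  then show ?thesis using that X(2) by blast
qed

text \<open>The image of \<open>f\<close>, taken as the kernel of its cokernel \<open>c\<close>, is
  non-zero and hence all of \<open>S\<close>; this forces \<open>c = 0\<close>.\<close>

lemma to_simple_epi:
  assumes S: "simple_object A S" and f: "arr f U S" and nz: "f \<noteq> zero_arr U S"
  shows "epimorphism A U S f"
proof -
  obtain C c where c: "is_cokernel A U S C f c" by (rule obtain_cokernel[OF f])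
  note ca = cokernelD(3)[OF c]
  obtain I i where i: "is_kernel A I S C i c" by (rule obtain_kernel[OF ca])
  obtain g where g: "arr g U I" "i \<bullet> g = f" by (rule kernel_factor[OF i f cokernelD(4)[OF c]])
  have "\<not> zero_object A I"
    using to_zero_object[of I g U] g nz zero_right[OF kernelD(2)[OF i] arr_dom[OF f]] by auto
  then have "isomorphism A I S i" using S kernelD(1)[OF i] by (auto simp: simple_object_def)
  then have c0: "c = zero_arr S C" using epiD[OF iso_mono_epi(2) ca kernelD(4)[OF i]] by simp
  have "h = zero_arr S W" if h: "arr h S W" "h \<bullet> f = zero_arr U W" for W h
  proof -
    obtain k where "arr k C W" "k \<bullet> c = h" by (rule cokernel_factor[OF c h])
    then show ?thesis using c0 zero_right[of k C W S] arr_dom[OF ca] by simp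
  qed
  then show ?thesis using f by (simp add: epi_iff)
qed

text \<open>Compare \<open>U\<close> with the last proper term \<open>X\<close> of the series:
  either \<open>U\<close> lies in \<open>X\<close>, or it maps onto the simple quotient
  \<open>S\<close> and its part \<open>W\<close> inside \<open>X\<close> is one step shorter. The
  clause on equal lengths later makes the kernel of a non-zero map strictly shorter.\<close>

lemma subobject_length:
  assumes "has_length n M" "monomorphism A U M u"
  shows "\<exists>m\<le>n. has_length m U \<and> (m = n \<longrightarrow> isomorphism A U M u)"
  using assms
proof (induction arbitrary: U u rule: has_length.induct)
  case (has_length_zero M)
  have u: "arr u U M" by (rule mono_arr[OF has_length_zero(2)])
  have U: "U \<in> Ob A" using arr_dom[OF u] .
  have "u \<bullet> ident A U = zero_arr U M"
    using to_zero_object[OF has_length_zero(1) u] ident_right[OF u] by simp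
  then have "ident A U = zero_arr U U" by (rule monoD[OF has_length_zero(2) arr_ident[OF U]])
  then have "zero_object A U" using U by (simp add: zero_object_iff)
  moreover have "epimorphism A U M u"
    using from_zero_object[OF has_length_zero(1)] u by (auto simp: epi_iff)
  ultimately show ?case using mono_epi_iso has_length_zero.prems has_length.has_length_zero by blast
next
  case (has_length_Suc n X M S x p)
  note se = short_exactD[OF has_length_Suc(2)] and um = has_length_Suc(5)
  have u: "arr u U M" by (rule mono_arr[OF um])
  have pu: "arr (p \<bullet> u) U S" using u se(6) by auto
  show ?case
  proof (cases "p \<bullet> u = zero_arr U S")
    case True
    obtain v where v: "arr v U X" "x \<bullet> v = u" by (rule kernel_factor[OF se(1) u True])
    have "monomorphism A U X v" using mono_factor[OF _ v(1) se(5)] v(2) um by simp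
    then obtain m where "m \<le> n" "has_length m U" using has_length_Suc.IH by blast
    \<comment> \<open>Here \<open>m\<close> is less than \<open>Suc n\<close>, so the clause on
      equal lengths holds vacuously.\<close>
    then show ?thesis by (intro exI[of _ m]) auto
  next
    case False
    have e: "epimorphism A U S (p \<bullet> u)" by (rule to_simple_epi[OF has_length_Suc(3) pu False])
    obtain W w where w: "short_exact A W U S w (p \<bullet> u)" by (rule epi_extends_short_exact[OF e])
    note sw = short_exactD[OF w]
    have uw: "arr (u \<bullet> w) W M" using u sw(5) by auto
    have "p \<bullet> (u \<bullet> w) = zero_arr W S" using assoc[OF sw(5) u se(6)] sw(7) by simp
    then obtain v where v: "arr v W X" "x \<bullet> v = u \<bullet> w" by (rule kernel_factor[OF se(1) uw])
    have "monomorphism A W X v"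
      using mono_factor[OF _ v(1) se(5)] v(2) mono_comp[OF sw(3) um] by simp
    then obtain m where m: "m \<le> n" "has_length m W" "m = n \<longrightarrow> isomorphism A W X v"
      using has_length_Suc.IH by blast
    \<comment> \<open>A map that kills \<open>U\<close> kills \<open>W\<close>, hence
      \<open>X\<close>, and descends to \<open>S\<close>; there it is zero because \<open>U\<close>
      maps onto \<open>S\<close>.\<close>
    have "epimorphism A U M u" if iso: "isomorphism A W X v"
    proof -
      have "g = zero_arr M Z" if g: "arr g M Z" "g \<bullet> u = zero_arr U Z" for g Z
      proof -
        note Z = arr_cod[OF g(1)]
        have gx: "arr (g \<bullet> x) X Z" using g(1) se(5) by auto
        have "g \<bullet> x \<bullet> v = g \<bullet> u \<bullet> w"
          using assoc[OF v(1) se(5) g(1)] v(2) assoc[OF sw(5) u g(1)] by simp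
        then have "g \<bullet> x \<bullet> v = zero_arr W Z" using g(2) zero_left[OF sw(5) Z] by simp
        then have "g \<bullet> x = zero_arr X Z" by (rule epiD[OF iso_mono_epi(2)[OF iso] gx])
        then obtain k where k: "arr k S Z" "k \<bullet> p = g" by (rule cokernel_factor[OF se(2) g(1)])
        have "k \<bullet> (p \<bullet> u) = zero_arr U Z" using assoc[OF u se(6) k(1)] k(2) g(2) by simp
        then have "k = zero_arr S Z" by (rule epiD[OF e k(1)])
        then show ?thesis using k(2) zero_left[OF se(6) Z] by simp
      qed
      then show ?thesis using u by (simp add: epi_iff)
    qed
    then have "m = n \<longrightarrow> isomorphism A U M u" using m(3) mono_epi_iso[OF um] by blast
    moreover have "has_length (Suc m) U"
      by (rule has_length.has_length_Suc[OF m(2) w has_length_Suc(3)])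
    ultimately show ?thesis using m(1) by (intro exI[of _ "Suc m"]) auto
  qed
qed

subsection \<open>Torsion pairs\<close>

text \<open>These serve as the torsion sequences of a torsion-free and of a torsion object,
  respectively.\<close>

lemma zero_short_exact:
  assumes Z: "zero_object A Z" and M: "M \<in> Ob A"
  shows "short_exact A Z M M (zero_arr Z M) (ident A M)"
    and "short_exact A M M Z (ident A M) (zero_arr M Z)"
proof -
  have ZO: "Z \<in> Ob A" using Z by (simp add: zero_object_def)
  note iM = ident_iso[OF M]
  have "monomorphism A Z M (zero_arr Z M)"
    using to_zero_object[OF Z] arr_zero[OF ZO M] by (auto simp: mono_iff)
  moreover have "is_cokernel A Z M M (zero_arr Z M) (ident A M)"
    using iso_mono_epi(2)[OF iM] arr_zero[OF ZO M] ident_left[OF arr_zero[OF ZO M]] ident_right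
    by (auto simp: cokernel_iff)
  ultimately show "short_exact A Z M M (zero_arr Z M) (ident A M)" by (rule mono_short_exact)
  have "epimorphism A M Z (zero_arr M Z)"
    using from_zero_object[OF Z] arr_zero[OF M ZO] by (auto simp: epi_iff)
  moreover have "is_kernel A M M Z (ident A M) (zero_arr M Z)"
    using iso_mono_epi(1)[OF iM] arr_zero[OF M ZO] ident_right[OF arr_zero[OF M ZO]] ident_left
    by (auto simp: kernel_iff)
  ultimately show "short_exact A M M Z (ident A M) (zero_arr M Z)" by (rule epi_short_exact)
qed

lemma zero_object_perp:
  assumes Z: "zero_object A Z" and C: "C \<subseteq> Ob A"
  shows "Z \<in> left_perp A C" "Z \<in> right_perp A C"
  using assms to_zero_object[OF Z] from_zero_object[OF Z]
  by (auto simp: left_perp_iff right_perp_iff zero_object_def)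

text \<open>
  If \<open>M\<close> is not in the torsion class, it has a non-zero map to some \<open>D \<in> C\<close>, whose kernel \<open>U\<close> is
  shorter than \<open>M\<close>. The torsion part of \<open>U\<close> is also that of \<open>M\<close>: its quotient in \<open>M\<close> is an extension
  of a subobject of \<open>D\<close> by a torsion-free object.
\<close>

lemma perp_torsion_sequence:
  assumes C: "C \<subseteq> Ob A" and "has_length n M" "M \<in> Ob A"
  shows "\<exists>X Y. torsion_sequence A (left_perp A C) (right_perp A (left_perp A C)) X M Y"
  using assms(2,3)
proof (induction n arbitrary: M rule: less_induct)
  case (less n)
  note T = left_perp_iff[OF C] and F = right_perp_iff[OF perp_subset(1)]
  obtain Z0 where Z0: "zero_object A Z0" using ex_zero_object by blast
  show ?case
  proof (cases "M \<in> left_perp A C")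
    case True
    then show ?thesis
      using zero_short_exact(2)[OF Z0 less.prems(2)] zero_object_perp(2)[OF Z0 perp_subset(1)]
      unfolding torsion_sequence_def by blast
  next
    case False
    then obtain D f where D: "D \<in> C" and f: "arr f M D" "f \<noteq> zero_arr M D"
      using less.prems(2) T by blast
    obtain U u where u: "is_kernel A U M D u f" by (rule obtain_kernel[OF f(1)])
    note uk = kernelD[OF u]
    obtain m where m: "m \<le> n" "has_length m U" "m = n \<longrightarrow> isomorphism A U M u"
      using subobject_length[OF less.prems(1) uk(1)] by blast
    \<comment> \<open>With equal lengths \<open>u\<close> would be an isomorphism, and
      \<open>f \<bullet> u = 0\<close> would give \<open>f = 0\<close>.\<close>
    have "m \<noteq> n" using m(3) epiD[OF iso_mono_epi(2) f(1) uk(4)] f(2) by blast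
    with m(1) have "m < n" by simp
    from less.IH[OF this m(2) arr_dom[OF uk(2)]]
    obtain X Y a p where X: "X \<in> left_perp A C" and Y: "Y \<in> right_perp A (left_perp A C)"
      and ap: "short_exact A X U Y a p"
      unfolding torsion_sequence_def by blast
    note se = short_exactD[OF ap]
    have "monomorphism A X M (u \<bullet> a)" by (rule mono_comp[OF se(3) uk(1)])
    then obtain Z q where q: "short_exact A X M Z (u \<bullet> a) q" by (rule mono_extends_short_exact)
    note sq = short_exactD[OF q]
    have "f \<bullet> (u \<bullet> a) = zero_arr X D"
      using assoc[OF se(5) uk(2) f(1)] uk(4) zero_left[OF se(5) arr_cod[OF f(1)]] by simp
    then obtain f' where f': "arr f' Z D" "f' \<bullet> q = f" by (rule cokernel_factor[OF sq(2) f(1)])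
    \<comment> \<open>In terms of elements: \<open>f'\<close> kills the image of \<open>h\<close>,
      as \<open>V\<close> has no maps to \<open>D\<close>, so preimages in \<open>M\<close> lie in
      \<open>U\<close>. Modulo \<open>X\<close> they define a map from \<open>V\<close> to
      \<open>Y\<close>, which is zero; hence they lie in \<open>X\<close> and \<open>h\<close>
      vanishes. The pullback \<open>P\<close> supplies the preimages.\<close>
    have "h = zero_arr V Z" if V: "V \<in> left_perp A C" and h: "arr h V Z" for V h
    proof -
      obtain P c b where c: "arr c P M" and b: "epimorphism A P V b" and qc: "q \<bullet> c = h \<bullet> b"
        by (rule pullback_epi[OF sq(4) h])
      note ba = epi_arr[OF b]
      have "f' \<bullet> h = zero_arr V D" using V T D arr_comp[OF h f'(1)] by blast
      then have "f \<bullet> c = zero_arr P D"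
        using assoc[OF c sq(6) f'(1)] f'(2) qc assoc[OF ba h f'(1)]
          zero_left[OF ba arr_cod[OF f(1)]] by simp
      then obtain c' where c': "arr c' P U" "u \<bullet> c' = c" by (rule kernel_factor[OF u c])
      obtain N i where i: "short_exact A N P V i b" by (rule epi_extends_short_exact[OF b])
      note si = short_exactD[OF i]
      have ci: "arr (c' \<bullet> i) N U" using c'(1) si(5) by auto
      \<comment> \<open>On the kernel \<open>N\<close> of \<open>b\<close> the lift
        \<open>c'\<close> factors through \<open>X\<close>, so \<open>p \<bullet> c'\<close>
        vanishes there and descends to \<open>V\<close>.\<close>
      have "q \<bullet> (u \<bullet> (c' \<bullet> i)) = h \<bullet> (b \<bullet> i)"
        using assoc[OF si(5) c'(1) uk(2)] c'(2) assoc[OF si(5) c sq(6)] qc assoc[OF si(5) ba h]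
        by simp
      also have "\<dots> = zero_arr N Z" using si(7) zero_right[OF h arr_dom[OF si(5)]] by simp
      finally obtain s where s: "arr s N X" "u \<bullet> a \<bullet> s = u \<bullet> (c' \<bullet> i)"
        by (rule kernel_factor[OF sq(1) arr_comp[OF ci uk(2)]])
      then have "u \<bullet> (a \<bullet> s) = u \<bullet> (c' \<bullet> i)" using assoc[OF s(1) se(5) uk(2)] by simp
      then have as: "a \<bullet> s = c' \<bullet> i" by (rule mono_cancel[OF uk(1) arr_comp[OF s(1) se(5)] ci])
      have pc: "arr (p \<bullet> c') P Y" using c'(1) se(6) by auto
      have "p \<bullet> c' \<bullet> i = zero_arr N Y"
        using assoc[OF si(5) c'(1) se(6)] as assoc[OF s(1) se(5,6)] se(7)
          zero_left[OF s(1) arr_cod[OF se(6)]] by simp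
      then obtain d where d: "arr d V Y" "d \<bullet> b = p \<bullet> c'" by (rule cokernel_factor[OF si(2) pc])
      have "d = zero_arr V Y" using Y F V d(1) by blast
      then have "p \<bullet> c' = zero_arr P Y" using d(2) zero_left[OF ba arr_cod[OF d(1)]] by simp
      then obtain t where t: "arr t P X" "a \<bullet> t = c'" by (rule kernel_factor[OF se(1) c'(1)])
      have "q \<bullet> c = q \<bullet> (u \<bullet> a \<bullet> t)" using c'(2) t(2) assoc[OF t(1) se(5) uk(2)] by simp
      also have "\<dots> = zero_arr P Z"
        using assoc[OF t(1) sq(5,6)] sq(7) zero_left[OF t(1) arr_cod[OF sq(6)]] by simp
      finally show ?thesis using epiD[OF b h] qc by simp
    qed
    then have "Z \<in> right_perp A (left_perp A C)" using F arr_cod[OF sq(6)] by blast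
    then show ?thesis using X q unfolding torsion_sequence_def by blast
  qed
qed

text \<open>Orthogonality and closure under isomorphism come with the perpendiculars; the content is
  the torsion sequence, found by induction on length. Any set \<open>C\<close> is admissible, and
  both nested families are obtained by varying it.\<close>

theorem perp_torsion_pair:
  assumes C: "C \<subseteq> Ob A"
  shows "torsion_pair A (left_perp A C) (right_perp A (left_perp A C))"
  using full_left_perp[OF C] full_right_perp[OF perp_subset(1), of C]
    perp_torsion_sequence[OF C] obtain_length
  unfolding torsion_pair_def right_perp_def by blast

text \<open>The identity of \<open>M\<close> is a map from a torsion to a torsion-free object. For
  non-zero objects this turns membership in one class into exclusion from the other.\<close>

lemma not_both_perp:
  assumes "M \<in> left_perp A C" "M \<in> right_perp A (left_perp A C)"
  shows "zero_object A M"
  using assms arr_ident right_perp_iff[OF perp_subset(1)] perp_subset(1)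
  by (auto simp: zero_object_iff)

text \<open>The trivial sequence gives the choice operator something to choose. In the chosen
  sequence the inclusion of the torsion part is a map into \<open>F\<close>, hence zero, so the
  projection is mono as well as epi. \<open>F\<close> may thus be an intersection of torsion-free
  classes.\<close>

lemma torsion_free_part_of_torsion_free:
  assumes F: "F \<subseteq> Ob A" and M: "M \<in> F"
  shows "isomorphic A M (torsion_free_part A (left_perp A F) F M)"
proof -
  obtain Z where Z: "zero_object A Z" using ex_zero_object by blast
  have MO: "M \<in> Ob A" using F M by blast
  have "\<exists>Y X. torsion_sequence A (left_perp A F) F X M Y"
    using zero_short_exact(1)[OF Z MO] zero_object_perp(1)[OF Z F] M
    unfolding torsion_sequence_def by blast
  then have "\<exists>X. torsion_sequence A (left_perp A F) F X M (torsion_free_part A (left_perp A F) F M)"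
    unfolding torsion_free_part_def by (rule someI_ex)
  then obtain X i p where X: "X \<in> left_perp A F"
    and ip: "short_exact A X M (torsion_free_part A (left_perp A F) F M) i p"
      (is "short_exact A X M ?Y i p")
    unfolding torsion_sequence_def by blast
  note se = short_exactD[OF ip]
  have i0: "i = zero_arr X M" using X left_perp_iff[OF F] M se(5) by blast
  have "h = zero_arr W M" if h: "arr h W M" "p \<bullet> h = zero_arr W ?Y" for W h
  proof -
    obtain t where "arr t W X" "i \<bullet> t = h" by (rule kernel_factor[OF se(1) h])
    then show ?thesis using zero_left[of t W X M] i0 MO by simp
  qed
  then have "monomorphism A M ?Y p" using se(6) by (simp add: mono_iff)
  then show ?thesis using mono_epi_iso se(4) unfolding isomorphic_def by blast
qed

text \<open>Dually, the projection of the chosen sequence is zero, so the inclusion of the torsion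
  part is epi as well as mono.\<close>

lemma torsion_part_of_torsion:
  assumes T: "T \<subseteq> Ob A" and M: "M \<in> T"
  shows "isomorphic A M (torsion_part A T (right_perp A T) M)"
proof -
  obtain Z where Z: "zero_object A Z" using ex_zero_object by blast
  have MO: "M \<in> Ob A" using T M by blast
  have "\<exists>X Y. torsion_sequence A T (right_perp A T) X M Y"
    using zero_short_exact(2)[OF Z MO] zero_object_perp(2)[OF Z T] M
    unfolding torsion_sequence_def by blast
  then have "\<exists>Y. torsion_sequence A T (right_perp A T) (torsion_part A T (right_perp A T) M) M Y"
    unfolding torsion_part_def by (rule someI_ex)
  then obtain Y i p where Y: "Y \<in> right_perp A T"
    and ip: "short_exact A (torsion_part A T (right_perp A T) M) M Y i p"
      (is "short_exact A ?X M Y i p")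
    unfolding torsion_sequence_def by blast
  note se = short_exactD[OF ip]
  have p0: "p = zero_arr M Y" using Y right_perp_iff[OF T] M se(6) by blast
  have "h = zero_arr M W" if h: "arr h M W" "h \<bullet> i = zero_arr ?X W" for W h
  proof -
    obtain t where "arr t Y W" "t \<bullet> p = h" by (rule cokernel_factor[OF se(2) h])
    then show ?thesis using zero_right[of t Y W M] p0 MO by simp
  qed
  then have "epimorphism A ?X M i" using se(5) by (simp add: epi_iff)
  then show ?thesis using mono_epi_iso se(3) isomorphic_sym unfolding isomorphic_def by blast
qed

subsection \<open>Split extensions\<close>

text \<open>The second summand is the subobject and the first the quotient, as in
  \<open>Ext1_zero\<close>. A map killed by \<open>pX\<close> has only its \<open>Y\<close>
  component left in the decomposition of the identity.\<close>

lemma biproduct_short_exact: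
  assumes "is_biproduct A X Y B iX iY pX pY"
  shows "short_exact A Y B X iY pX"
proof -
  have b: "arr iX X B" "arr iY Y B" "arr pX B X" "arr pY B Y" "pX \<bullet> iX = ident A X"
    "pY \<bullet> iY = ident A Y" "pX \<bullet> iY = zero_arr Y X"
    and id: "(iX \<bullet> pX) \<oplus>\<^bsub>Hom A B B\<^esub> (iY \<bullet> pY) = ident A B"
    using assms by (auto simp: is_biproduct_def arr_def)
  have ip: "arr (iX \<bullet> pX) B B" "arr (iY \<bullet> pY) B B" using b by auto
  have "h = zero_arr W Y" if h: "arr h W Y" "iY \<bullet> h = zero_arr W B" for W h
    using assoc[OF h(1) b(2,4)] b(6) ident_left[OF h(1)] h(2) zero_right[OF b(4) arr_dom[OF h(1)]]
    by simp
  then have "monomorphism A Y B iY" using b by (simp add: mono_iff)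
  moreover have "g = zero_arr X W" if g: "arr g X W" "g \<bullet> pX = zero_arr B W" for W g
    using assoc[OF b(1,3) g(1)] b(5) ident_right[OF g(1)] g(2) zero_left[OF b(1) arr_cod[OF g(1)]]
    by simp
  then have e: "epimorphism A B X pX" using b by (simp add: epi_iff)
  moreover have "\<exists>u. arr u W Y \<and> iY \<bullet> u = h" if h: "arr h W B" "pX \<bullet> h = zero_arr W X" for W h
  proof -
    have "h = (iX \<bullet> pX \<bullet> h) \<oplus>\<^bsub>Hom A W B\<^esub> (iY \<bullet> pY \<bullet> h)"
      using add_left[OF h(1) ip] id ident_left[OF h(1)] by simp
    also have "iX \<bullet> pX \<bullet> h = zero_arr W B"
      using assoc[OF h(1) b(3,1)] h(2) zero_right[OF b(1) arr_dom[OF h(1)]] by simp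
    also have "zero_arr W B \<oplus>\<^bsub>Hom A W B\<^esub> (iY \<bullet> pY \<bullet> h) = iY \<bullet> pY \<bullet> h"
      by (rule add_zero_left[OF arr_comp[OF h(1) ip(2)]])
    finally show ?thesis using assoc[OF h(1) b(4,2)] arr_comp[OF h(1) b(4)] by metis
  qed
  ultimately have "is_kernel A Y B X iY pX" using b by (simp add: kernel_iff)
  with e show ?thesis by (rule epi_short_exact)
qed

text \<open>The projection \<open>e = ident A E - s \<bullet> p\<close> complementary to the section
  is killed by \<open>p\<close>, so it factors as \<open>i \<bullet> r\<close>, and \<open>r\<close>
  is the missing retraction.\<close>

lemma section_biproduct:
  assumes ip: "short_exact A Y E X i p" and s: "arr s X E" "p \<bullet> s = ident A X"
  obtains r where "is_biproduct A X Y E s i p r"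
proof -
  note se = short_exactD[OF ip]
  have E: "E \<in> Ob A" and X: "X \<in> Ob A" and Y: "Y \<in> Ob A"
    using se(5,6) by (auto simp: arr_def)
  have sp: "arr (s \<bullet> p) E E" using s se by auto
  define e where "e = ident A E \<ominus>\<^bsub>Hom A E E\<^esub> (s \<bullet> p)"
  have e: "arr e E E" using sp E by (auto simp: e_def)
  have psp: "p \<bullet> (s \<bullet> p) = p"
    using assoc[OF se(6) s(1) se(6)] s(2) ident_left[OF se(6)] by simp
  have "p \<bullet> e = zero_arr E X"
    using diff_right[OF arr_ident[OF E] sp se(6)] psp ident_right[OF se(6)] diff_self[OF se(6)]
    by (simp add: e_def)
  then obtain r where r: "arr r E Y" "i \<bullet> r = e" by (rule kernel_factor[OF se(1) e])
  have ei: "e \<bullet> i = i"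
  proof -
    have "s \<bullet> p \<bullet> i = zero_arr Y E" using assoc[OF se(5,6) s(1)] se(7) zero_right[OF s(1) Y] by simp
    then have "e \<bullet> i = i \<ominus>\<^bsub>Hom A Y E\<^esub> zero_arr Y E"
      using diff_left[OF se(5) arr_ident[OF E] sp] ident_left[OF se(5)] by (simp add: e_def)
    also have "\<dots> = i"
      using diff_add[OF se(5) arr_zero[OF Y E]]
        add_zero_right[OF arr_diff[OF se(5) arr_zero[OF Y E]]] by simp
    finally show ?thesis .
  qed
  have es: "e \<bullet> s = zero_arr X E"
    using diff_left[OF s(1) arr_ident[OF E] sp] assoc[OF s(1) se(6) s(1)] s(2) ident_right[OF s(1)]
      ident_left[OF s(1)] diff_self[OF s(1)] by (simp add: e_def)
  have "i \<bullet> (r \<bullet> i) = i \<bullet> ident A Y"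
    using assoc[OF se(5) r(1) se(5)] r(2) ei ident_right[OF se(5)] by simp
  then have ri: "r \<bullet> i = ident A Y"
    using mono_cancel[OF se(3)] arr_comp[OF se(5) r(1)] arr_ident[OF Y] by blast
  have "i \<bullet> (r \<bullet> s) = zero_arr X E" using assoc[OF s(1) r(1) se(5)] r(2) es by simp
  then have rs: "r \<bullet> s = zero_arr X Y" by (rule monoD[OF se(3) arr_comp[OF s(1) r(1)]])
  have "e \<oplus>\<^bsub>Hom A E E\<^esub> (s \<bullet> p) = ident A E"
    unfolding e_def by (rule diff_add[OF arr_ident[OF E] sp])
  then have "(s \<bullet> p) \<oplus>\<^bsub>Hom A E E\<^esub> (i \<bullet> r) = ident A E"
    using r(2) e sp E abelian_monoid.a_comm[OF abelian_group.axioms(1)[OF hom_group]]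
    by (metis arr_hom)
  then have "is_biproduct A X Y E s i p r"
    using ri rs s se(5-7) r(1) by (simp add: is_biproduct_def arr_def)
  then show ?thesis by (rule that)
qed

text \<open>The map \<open>i' \<bullet> r + s' \<bullet> p\<close> matches the summands and so
  respects both ends. That it is an isomorphism is the short five lemma, carried out as a mono and
  an epi test.\<close>

lemma biproduct_ext_rel:
  assumes B: "is_biproduct A X Y B s i p r" and B': "is_biproduct A X Y B' s' i' p' r'"
  shows "((B, i, p), (B', i', p')) \<in> ext_rel A X Y"
proof -
  have b: "arr s X B" "arr i Y B" "arr p B X" "arr r B Y" "p \<bullet> s = ident A X"
    "r \<bullet> i = ident A Y" "p \<bullet> i = zero_arr Y X"
    using B by (auto simp: is_biproduct_def arr_def)
  have b': "arr s' X B'" "arr i' Y B'" "arr p' B' X" "arr r' B' Y" "p' \<bullet> s' = ident A X"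
    "r' \<bullet> i' = ident A Y" "p' \<bullet> i' = zero_arr Y X"
    using B' by (auto simp: is_biproduct_def arr_def)
  note se = short_exactD[OF biproduct_short_exact[OF B]]
  note se' = short_exactD[OF biproduct_short_exact[OF B']]
  have X: "X \<in> Ob A" and Y: "Y \<in> Ob A" and BO: "B \<in> Ob A"
    using b by (auto simp: arr_def)
  define f where "f = (i' \<bullet> r) \<oplus>\<^bsub>Hom A B B'\<^esub> (s' \<bullet> p)"
  have ir: "arr (i' \<bullet> r) B B'" and sp: "arr (s' \<bullet> p) B B'" using b b' by auto
  then have f: "arr f B B'" by (auto simp: f_def)
  have "i' \<bullet> r \<bullet> i = i'" using assoc[OF b(2,4) b'(2)] b(6) ident_right[OF b'(2)] by simp
  moreover have "s' \<bullet> p \<bullet> i = zero_arr Y B'"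
    using assoc[OF b(2,3) b'(1)] b(7) zero_right[OF b'(1) Y] by simp
  ultimately have fi: "f \<bullet> i = i'"
    using add_left[OF b(2) ir sp] add_zero_right[OF b'(2)] by (simp add: f_def)
  have "p' \<bullet> (i' \<bullet> r) = zero_arr B X" using assoc[OF b(4) b'(2,3)] b'(7) zero_left[OF b(4) X] by simp
  moreover have "p' \<bullet> (s' \<bullet> p) = p" using assoc[OF b(3) b'(1,3)] b'(5) ident_left[OF b(3)] by simp
  ultimately have pf: "p' \<bullet> f = p"
    using add_right[OF ir sp b'(3)] add_zero_left[OF b(3)] by (simp add: f_def)
  have "h = zero_arr W B" if h: "arr h W B" "f \<bullet> h = zero_arr W B'" for W h
  proof -
    note W = arr_dom[OF h(1)]
    have "p \<bullet> h = zero_arr W X"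
      using assoc[OF h(1) f b'(3)] pf h(2) zero_right[OF b'(3) W] by simp
    then obtain k where k: "arr k W Y" "i \<bullet> k = h" by (rule kernel_factor[OF se(1) h(1)])
    have "i' \<bullet> k = zero_arr W B'" using assoc[OF k(1) b(2) f] fi k(2) h(2) by simp
    then have "k = zero_arr W Y" by (rule monoD[OF se'(3) k(1)])
    then show ?thesis using k(2) zero_right[OF b(2) W] by simp
  qed
  then have "monomorphism A B B' f" using f by (simp add: mono_iff)
  moreover have "g = zero_arr B' W" if g: "arr g B' W" "g \<bullet> f = zero_arr B W" for W g
  proof -
    note W = arr_cod[OF g(1)]
    have "g \<bullet> i' = zero_arr Y W" using assoc[OF b(2) f g(1)] fi g(2) zero_left[OF b(2) W] by simp
    then obtain k where k: "arr k X W" "k \<bullet> p' = g" by (rule cokernel_factor[OF se'(2) g(1)])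
    have "k \<bullet> p = zero_arr B W" using assoc[OF f b'(3) k(1)] pf k(2) g(2) by simp
    then have "k = zero_arr X W" by (rule epiD[OF se(4) k(1)])
    then show ?thesis using k(2) zero_left[OF b'(3) W] by simp
  qed
  then have "epimorphism A B B' f" using f by (simp add: epi_iff)
  ultimately have "isomorphism A B B' f" by (rule mono_epi_iso)
  then show ?thesis
    using fi pf biproduct_short_exact[OF B] biproduct_short_exact[OF B']
    by (auto simp: ext_rel_def Defs.extensions_def)
qed

text \<open>Replaces the Yoneda quotient by the splitting of every extension. An extension in the
  zero class inherits a section from a biproduct; conversely, if all extensions split, all are
  biproducts and any two are equivalent.\<close>

lemma ext1_vanishes_iff:
  assumes "X \<in> Ob A" "Y \<in> Ob A"
  shows "ext1_vanishes A X Y \<longleftrightarrow>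
    (\<forall>E i p. short_exact A Y E X i p \<longrightarrow> (\<exists>s. arr s X E \<and> p \<bullet> s = ident A X))"
    (is "_ \<longleftrightarrow> ?R")
proof
  assume v: "ext1_vanishes A X Y"
  show ?R
  proof (intro allI impI)
    fix E i p assume ip: "short_exact A Y E X i p"
    note se = short_exactD[OF ip]
    have x: "(E, i, p) \<in> Defs.extensions A X Y" using ip by (simp add: Defs.extensions_def)
    then have "ext_rel A X Y `` {(E, i, p)} = Ext1_zero A X Y"
      using v quotientI[OF x, of "ext_rel A X Y"] by (simp add: ext1_vanishes_def Ext1_def)
    moreover have "((E, i, p), (E, i, p)) \<in> ext_rel A X Y"
      using x ident_iso[OF arr_cod[OF se(5)]] ident_left[OF se(5)] ident_right[OF se(6)]
      by (auto simp: ext_rel_def)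
    ultimately have "(E, i, p) \<in> Ext1_zero A X Y" by blast
    then obtain B iX iY pX pY f where B: "is_biproduct A X Y B iX iY pX pY"
      and f: "isomorphism A B E f" "p \<bullet> f = pX"
      by (auto simp: Ext1_zero_def ext_rel_def)
    have "arr f B E" "arr iX X B" "pX \<bullet> iX = ident A X"
      using B f by (auto simp: iso_iff is_biproduct_def arr_def)
    then show "\<exists>s. arr s X E \<and> p \<bullet> s = ident A X"
      using assoc[of iX X B f E p X] f(2) se(6) by (intro exI[of _ "f \<bullet> iX"]) auto
  qed
next
  assume R: ?R
  have split: "\<exists>s r. is_biproduct A X Y E s i p r" if "(E, i, p) \<in> Defs.extensions A X Y" for E i p
    using R that section_biproduct unfolding Defs.extensions_def by blast
  have rel: "ext_rel A X Y = Defs.extensions A X Y \<times> Defs.extensions A X Y"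
  proof
    show "ext_rel A X Y \<subseteq> Defs.extensions A X Y \<times> Defs.extensions A X Y"
      by (auto simp: ext_rel_def)
    show "Defs.extensions A X Y \<times> Defs.extensions A X Y \<subseteq> ext_rel A X Y"
      using split biproduct_ext_rel by (clarify, metis)
  qed
  \<comment> \<open>A biproduct shows that there is an extension at all; otherwise the quotient
    would be empty instead of a single class.\<close>
  obtain B iX iY pX pY where B: "is_biproduct A X Y B iX iY pX pY"
    using ex_biproduct[OF assms] by metis
  have x: "(B, iY, pX) \<in> Defs.extensions A X Y"
    using biproduct_short_exact[OF B] by (simp add: Defs.extensions_def)
  have "(B, iY, pX) \<in> {(B, iY, pX) |B iX iY pX pY. is_biproduct A X Y B iX iY pX pY}"
    using B by auto
  then have "Ext1_zero A X Y = Defs.extensions A X Y"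
    using x unfolding Ext1_zero_def rel by fast
  moreover have "Ext1 A X Y = {Defs.extensions A X Y}"
    using x unfolding Ext1_def quotient_def rel by auto
  ultimately show "ext1_vanishes A X Y" by (simp add: ext1_vanishes_def)
qed

text \<open>Composing the inclusion with \<open>\<phi>\<close> gives an extension by
  \<open>Y\<close> with the same middle term and projection, so its section splits the given
  extension.\<close>

lemma ext1_vanishes_iso_right:
  assumes v: "ext1_vanishes A X Y" and X: "X \<in> Ob A" and YY': "isomorphic A Y Y'"
  shows "ext1_vanishes A X Y'"
proof -
  obtain \<phi> where \<phi>: "isomorphism A Y Y' \<phi>" using YY' by (auto simp: isomorphic_def)
  then have \<phi>a: "arr \<phi> Y Y'" by (simp add: iso_iff)
  have "\<exists>s. arr s X E \<and> p \<bullet> s = ident A X" if "short_exact A Y' E X i p" for E i p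
  proof -
    note se = short_exactD[OF that]
    have i\<phi>: "arr (i \<bullet> \<phi>) Y E" using \<phi>a se(5) by auto
    have "is_cokernel A Y E X (i \<bullet> \<phi>) p"
      unfolding cokernel_iff
    proof (intro conjI allI impI)
      show "p \<bullet> (i \<bullet> \<phi>) = zero_arr Y X" using assoc[OF \<phi>a se(5,6)] se(7) zero_left[OF \<phi>a X] by simp
    next
      fix W h assume h: "arr h E W" "h \<bullet> (i \<bullet> \<phi>) = zero_arr Y W"
      have "h \<bullet> i \<bullet> \<phi> = zero_arr Y W" using assoc[OF \<phi>a se(5) h(1)] h(2) by simp
      then have "h \<bullet> i = zero_arr Y' W"
        by (rule epiD[OF iso_mono_epi(2)[OF \<phi>] arr_comp[OF se(5) h(1)]])
      then show "\<exists>u. arr u X W \<and> u \<bullet> p = h" using cokernel_factor[OF se(2) h(1)] by blast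
    qed (fact se i\<phi>)+
    then have "short_exact A Y E X (i \<bullet> \<phi>) p"
      using mono_comp[OF iso_mono_epi(1)[OF \<phi>] se(3)] mono_short_exact by blast
    then show ?thesis using v ext1_vanishes_iff[OF X arr_dom[OF \<phi>a]] by blast
  qed
  then show ?thesis using ext1_vanishes_iff[OF X arr_cod[OF \<phi>a]] by blast
qed

lemma ext1_vanishes_iso_left:
  assumes v: "ext1_vanishes A X Y" and Y: "Y \<in> Ob A" and XX': "isomorphic A X X'"
  shows "ext1_vanishes A X' Y"
proof -
  obtain \<phi> where \<phi>: "isomorphism A X' X \<phi>"
    using isomorphic_sym[OF XX'] by (auto simp: isomorphic_def)
  obtain \<psi> where \<phi>a: "arr \<phi> X' X" and \<psi>: "arr \<psi> X X'" "\<psi> \<bullet> \<phi> = ident A X'"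
    by (rule isoE[OF \<phi>])
  have X': "X' \<in> Ob A" by (rule arr_dom[OF \<phi>a])
  have "\<exists>s. arr s X' E \<and> p \<bullet> s = ident A X'" if "short_exact A Y E X' i p" for E i p
  proof -
    note se = short_exactD[OF that]
    have \<phi>p: "arr (\<phi> \<bullet> p) E X" using \<phi>a se(6) by auto
    have "is_kernel A Y E X i (\<phi> \<bullet> p)"
      unfolding kernel_iff
    proof (intro conjI allI impI)
      show "\<phi> \<bullet> p \<bullet> i = zero_arr Y X" using assoc[OF se(5,6) \<phi>a] se(7) zero_right[OF \<phi>a Y] by simp
    next
      fix W h assume h: "arr h W E" "\<phi> \<bullet> p \<bullet> h = zero_arr W X"
      have "\<phi> \<bullet> (p \<bullet> h) = zero_arr W X" using assoc[OF h(1) se(6) \<phi>a] h(2) by simp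
      then have "p \<bullet> h = zero_arr W X'"
        by (rule monoD[OF iso_mono_epi(1)[OF \<phi>] arr_comp[OF h(1) se(6)]])
      then show "\<exists>u. arr u W Y \<and> i \<bullet> u = h" using kernel_factor[OF se(1) h(1)] by blast
    qed (fact se \<phi>p)+
    moreover have "epimorphism A E X (\<phi> \<bullet> p)"
    proof -
      have "g = zero_arr X W" if g: "arr g X W" "g \<bullet> (\<phi> \<bullet> p) = zero_arr E W" for W g
        using assoc[OF se(6) \<phi>a g(1)] g(2) epiD[OF se(4) arr_comp[OF \<phi>a g(1)]]
          epiD[OF iso_mono_epi(2)[OF \<phi>] g(1)] by simp
      then show ?thesis using \<phi>p by (simp add: epi_iff)
    qed
    ultimately have "short_exact A Y E X i (\<phi> \<bullet> p)" using epi_short_exact by blast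
    then obtain s where s: "arr s X E" "\<phi> \<bullet> p \<bullet> s = ident A X"
      using v ext1_vanishes_iff[OF arr_cod[OF \<phi>a] Y] by blast
    have ps: "arr (p \<bullet> s) X X'" using s(1) se(6) by auto
    \<comment> \<open>Here the projection has changed to \<open>\<phi> \<bullet> p\<close>.
      Cancelling \<open>\<phi>\<close> identifies \<open>p \<bullet> s\<close> with the inverse
      \<open>\<psi>\<close>, so \<open>s \<bullet> \<phi>\<close> is a section of
      \<open>p\<close>.\<close>
    have "p \<bullet> s = \<psi> \<bullet> (\<phi> \<bullet> (p \<bullet> s))"
      using assoc[OF ps \<phi>a \<psi>(1)] \<psi>(2) ident_left[OF ps] by simp
    also have "\<dots> = \<psi>" using assoc[OF s(1) se(6) \<phi>a] s(2) ident_right[OF \<psi>(1)] by simp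
    finally have "p \<bullet> (s \<bullet> \<phi>) = ident A X'" using assoc[OF \<phi>a s(1) se(6)] \<psi>(2) by simp
    then show ?thesis using arr_comp[OF \<phi>a s(1)] by blast
  qed
  then show ?thesis using ext1_vanishes_iff[OF X' Y] by blast
qed

end

section \<open>Pre-stratifying systems\<close>

theorem theorem4p10:
  fixes K :: "('k, 'r) ring_scheme"
    and A :: "('k, 'o, 'm) linear_cat"
    and \<Omega> :: "'g::linorder \<Rightarrow> 'o"
  assumes "abelian_length_category K A"
    and "pre_stratifying_system A \<Omega>"
  shows "(\<exists>\<Gamma> :: 'g \<Rightarrow> 'o set \<times> 'o set. nested_torsion_pairs A \<Gamma> \<and>
            (\<exists>M \<in> M_dagger A \<Gamma>. \<forall>k. isomorphic A (\<Omega> k) (frak_F A \<Gamma> k M))) \<and>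
         (\<exists>\<Gamma>' :: 'g \<Rightarrow> 'o set \<times> 'o set. nested_torsion_pairs A \<Gamma>' \<and>
            (\<exists>N \<in> N_dagger A \<Gamma>'. \<forall>k. isomorphic A (\<Omega> k) (frak_T A \<Gamma>' k N)))"
proof -
  interpret abelian_length_category K A by (rule assms(1))
  have \<Omega>: "\<Omega> k \<in> Ob A" and nz: "\<not> zero_object A (\<Omega> k)" for k
    using assms(2) by (auto simp: pre_stratifying_system_def)
  have hom: "hom_zero A (\<Omega> k) (\<Omega> j)" if "j < k" for j k
    using assms(2) that by (auto simp: pre_stratifying_system_def)
  have ext: "ext1_vanishes A (\<Omega> k) (\<Omega> j)" if "j \<le> k" for j k
    using assms(2) that by (auto simp: pre_stratifying_system_def)
  have Gr: "\<Omega> \<in> Ob (Gr A)" using \<Omega> by (simp add: Gr_def)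
  have nzf: "\<not> zero_family A \<Omega>" using nz by (simp add: zero_family_def)
  have antimono: "left_perp A D \<subseteq> left_perp A C" "right_perp A D \<subseteq> right_perp A C"
    if "C \<subseteq> D" for C D
    using that by (auto simp: left_perp_def right_perp_def)

  have part1: "\<exists>\<Gamma> :: 'g \<Rightarrow> 'o set \<times> 'o set. nested_torsion_pairs A \<Gamma> \<and>
    (\<exists>M \<in> M_dagger A \<Gamma>. \<forall>k. isomorphic A (\<Omega> k) (frak_F A \<Gamma> k M))"
  proof -
    \<comment> \<open>\<open>C k\<close> is already the intended torsion-free class. Writing it as a
      double perpendicular in \<open>\<Gamma>\<close> does not change it and gives the form treated
      by \<open>perp_torsion_pair\<close>.\<close>
    define C where "C k = right_perp A (\<Omega> ` {k..})" for k
    define \<Gamma> where "\<Gamma> k = (left_perp A (C k), right_perp A (left_perp A (C k)))" for k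
    have C: "C k \<subseteq> Ob A" for k using perp_subset by (simp add: C_def)
    have inT: "\<Omega> k \<in> left_perp A (C k)" for k
      using subset_left_right_perp[of "\<Omega> ` {k..}"] \<Omega> by (auto simp: C_def)
    \<comment> \<open>All objects defining \<open>C j\<close> have index at least
      \<open>j > k\<close>, so they have no non-zero maps to \<open>\<Omega> k\<close>.\<close>
    have "\<Omega> k \<in> C j" if "k < j" for j k
      using that hom \<Omega> by (auto simp: C_def right_perp_def)
    then have inF: "\<Omega> k \<in> right_perp A (left_perp A (C j))" if "k < j" for j k
      using that subset_right_left_perp[OF C] by blast
    have notT: "\<Omega> k \<notin> left_perp A (C j)" if "k < j" for j k
      using not_both_perp inF[OF that] nz by blast
    have sub: "left_perp A (C l) \<subseteq> left_perp A (C k)" if "k < l" for k l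
      unfolding C_def using that by (intro antimono image_mono) auto
    \<comment> \<open>The inclusion is strict because \<open>\<Omega> k\<close> lies in the class at
      \<open>k\<close> but not in the one at \<open>l\<close>.\<close>
    have "left_perp A (C l) \<subset> left_perp A (C k)" if "k < l" for k l
      using sub[OF that] inT[of k] notT[OF that] by blast
    then have nested: "nested_torsion_pairs A \<Gamma>"
      using perp_torsion_pair[OF C] by (simp add: nested_torsion_pairs_def \<Gamma>_def)
    \<comment> \<open>For a greatest index \<open>k\<close> the class \<open>F_above\<close> is all
      of \<open>Ob A\<close>, and membership reduces to
      \<open>\<Omega> k \<in> Ob A\<close>.\<close>
    have iso: "isomorphic A (\<Omega> k) (frak_F A \<Gamma> k \<Omega>)" for k
      unfolding frak_F_def using inF \<Omega>
      by (intro torsion_free_part_of_torsion_free) (auto simp: F_above_def \<Gamma>_def)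
    \<comment> \<open>The Ext condition refers to the chosen torsion-free parts, in the second
      argument; it is carried over along \<open>iso\<close>.\<close>
    have "\<Omega> \<in> M_dagger A \<Gamma>"
      using Gr nz nzf inT notT ext1_vanishes_iso_right[OF ext \<Omega> iso]
      by (auto simp: M_dagger_def cat_M_def \<Gamma>_def)
    then show ?thesis using nested iso by blast
  qed

  have part2: "\<exists>\<Gamma>' :: 'g \<Rightarrow> 'o set \<times> 'o set. nested_torsion_pairs A \<Gamma>' \<and>
    (\<exists>N \<in> N_dagger A \<Gamma>'. \<forall>k. isomorphic A (\<Omega> k) (frak_T A \<Gamma>' k N))"
  proof -
    \<comment> \<open>Starting from the objects themselves makes \<open>\<Omega> k\<close>
      torsion-free at \<open>k\<close>. It is torsion at each \<open>j < k\<close>, since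
      \<open>C j\<close> contains only objects of index below \<open>k\<close>.\<close>
    define C where "C k = \<Omega> ` {..k}" for k
    define \<Gamma> where "\<Gamma> k = (left_perp A (C k), right_perp A (left_perp A (C k)))" for k
    have C: "C k \<subseteq> Ob A" for k using \<Omega> by (auto simp: C_def)
    have inF: "\<Omega> k \<in> right_perp A (left_perp A (C k))" for k
      using subset_right_left_perp[OF C] by (auto simp: C_def)
    have inT: "\<Omega> k \<in> left_perp A (C j)" if "j < k" for j k
      using that hom \<Omega> by (auto simp: C_def left_perp_def)
    have notF: "\<Omega> k \<notin> right_perp A (left_perp A (C j))" if "j < k" for j k
      using not_both_perp inT[OF that] nz by blast
    have notT: "\<Omega> k \<notin> left_perp A (C k)" for k
      using not_both_perp inF nz by blast
    have sub: "left_perp A (C l) \<subseteq> left_perp A (C k)" if "k < l" for k l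
      unfolding C_def using that by (intro antimono image_mono) auto
    \<comment> \<open>Now the object of larger index separates: \<open>\<Omega> l\<close> is torsion
      at \<open>k\<close> but not at \<open>l\<close>.\<close>
    have "left_perp A (C l) \<subset> left_perp A (C k)" if "k < l" for k l
      using sub[OF that] inT[OF that] notT[of l] by blast
    then have nested: "nested_torsion_pairs A \<Gamma>"
      using perp_torsion_pair[OF C] by (simp add: nested_torsion_pairs_def \<Gamma>_def)
    have iso: "isomorphic A (\<Omega> k) (frak_T A \<Gamma> k \<Omega>)" for k
      unfolding frak_T_def using inT \<Omega>
      by (intro torsion_part_of_torsion) (auto simp: T_below_def \<Gamma>_def)
    \<comment> \<open>The chosen torsion parts stand in the first argument of Ext, hence the
      transport on the left.\<close>
    have "\<Omega> \<in> N_dagger A \<Gamma>"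
      using Gr nz nzf inF notF ext1_vanishes_iso_left[OF ext \<Omega> iso]
      by (auto simp: N_dagger_def cat_N_def \<Gamma>_def)
    then show ?thesis using nested iso by blast
  qed

  show ?thesis using part1 part2 by blast
qed

end
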